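(* Let $A$ be a locally finite algebra over a field $F$, $n$ a positive integer, and $G$ a subgroup of the general linear group $\mathrm{GL}_n(A)$. If $G$ is periodic, then $G$ is locally finite.
   Context: Algebras are associative with identity $1\ne 0$. An $F$-algebra $A$ is locally finite if every finite subset of $A$ generates a finite-dimensional $F$-subalgebra. $\mathrm{GL}_n(A)$ is the unit group of $\mathrm{M}_n(A)$. A group is periodic if each of its elements has finite order, and locally finite if all its finitely generated subgroups are finite. *)

theory Defs
  imports "Jordan_Normal_Form.Matrix" "HOL-Algebra.Generated_Groups"
begin

text \<open>
  Associative unital algebras over a field, not necessarily commutative. The type class
  \<open>ring_1\<close> of the carrier includes \<open>1 \<noteq> 0\<close>.
\<close>

locale field_algebra = vector_space scale
  for scale :: "'f :: field \<Rightarrow> 'a :: ring_1 \<Rightarrow> 'a" (infixr "*s" 75) +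
  assumes scale_mult_left: "(c *s x) * y = c *s (x * y)"
    and scale_mult_right: "x * (c *s y) = c *s (x * y)"
begin

definition subalgebra :: "'a set \<Rightarrow> bool" where
  "subalgebra B \<longleftrightarrow> subspace B \<and> 1 \<in> B \<and> (\<forall>x\<in>B. \<forall>y\<in>B. x * y \<in> B)"

definition finite_dimensional :: "'a set \<Rightarrow> bool" where
  "finite_dimensional V \<longleftrightarrow> (\<exists>T. finite T \<and> independent T \<and> span T = V)"

end

locale locally_finite_algebra = field_algebra +
  assumes finite_dimensional_generated: "finite S \<Longrightarrow> finite_dimensional (subalgebra hull S)"

definition periodic_group :: "('g, 'm) monoid_scheme \<Rightarrow> bool" where
  "periodic_group H \<longleftrightarrow> group H \<and> (\<forall>x\<in>carrier H. \<exists>k::nat. k > 0 \<and> x [^]\<^bsub>H\<^esub> k = \<one>\<^bsub>H\<^esub>)"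

definition locally_finite_group :: "('g, 'm) monoid_scheme \<Rightarrow> bool" where
  "locally_finite_group H \<longleftrightarrow>
     group H \<and> (\<forall>S. S \<subseteq> carrier H \<longrightarrow> finite S \<longrightarrow> finite (generate H S))"

definition general_linear_group :: "'a :: ring_1 itself \<Rightarrow> nat \<Rightarrow> 'a mat monoid" where
  "general_linear_group A n = units_of (ring_mat A n ())"

lemma group_general_linear_group: "group (general_linear_group TYPE('a :: ring_1) n)"
proof -
  interpret semiring "ring_mat TYPE('a) n ()"
    by (rule semiring_mat)
  show ?thesis
    unfolding general_linear_group_def by (rule units_group)
qed

end

theory Submission
  imports Defs
    "HOL-Algebra.Sylow" "HOL-Algebra.Multiplicative_Group" "HOL-Algebra.Group_Action"
    "Jordan_Normal_Form.Determinant" "HOL-Library.Function_Algebras"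
    "HOL-Computational_Algebra.Computational_Algebra"
begin

text \<open>
  The entries of finitely many matrices in \<open>G\<close> and of their inverses generate a finite-dimensional
  subalgebra, and its regular representation turns the group they generate into a finitely generated
  periodic group \<open>H\<close> of matrices over a finitely generated subring \<open>A\<close> of the field \<open>F\<close>. By the
  Nullstellensatz over \<open>\<int>\<close>, every nonzero element of \<open>A\<close> avoids a prime ideal \<open>P\<close> with finite residue
  ring, of characteristic \<open>p\<close> say, and the elements of the kernel of reduction modulo \<open>P\<close> have
  \<open>p\<close>-power order. If \<open>p \<noteq> 0\<close> in \<open>F\<close>, a second prime ideal not containing \<open>p\<close> has a kernel meeting the
  first one trivially, so \<open>H\<close> is finite. If \<open>p = 0\<close> in \<open>F\<close>, the kernel is a \<open>p\<close>-group modulo every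
  prime ideal with finite residue ring, hence unipotent modulo all of them, and so
  \<open>(x\<^sub>1 - 1) \<cdots> (x\<^sub>m - 1) = 0\<close> for all \<open>x\<^sub>1, \<dots>, x\<^sub>m\<close> in the kernel. The group generated by finitely
  many Schreier generators of the kernel therefore lies in the span over the prime field of finitely
  many products, and is finite.
\<close>

section \<open>Prime ideals with finite residue ring\<close>

text \<open>Periodicity bounds no orders, so finiteness can only come from the residue rings, each
  of which gives a congruence kernel of finite index. What remains is to control a kernel. Its
  p-power torsion follows from determinants: if X is congruent to 1 modulo P, then 1 + X + ... +
  X^(r-1) has determinant r^m modulo P and is invertible over the field when r is prime to p. If p
  is nonzero in F, the prime ideal avoiding p is obtained by applying the Nullstellensatz to the
  element p of A itself. In characteristic p all residue rings have characteristic p and two primes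
  no longer contradict each other; then a p-group acting on a nonzero finite vector space over a
  field of characteristic p has a nonzero fixed vector, hence acts unitriangularly, and m factors x
  - 1 kill a space of dimension m. Only finitely many such products with factors from a finite set
  are then nonzero. Avoiding a prescribed nonzero element is the form of the Nullstellensatz that
  survives adjoining one generator at a time. Quotient rings are never formed: rings and ideals are
  subsets of the field, and residue classes are handled through chosen representatives.\<close>

locale coeff_ring =
  fixes A :: "'a::field set"
  assumes one: "1 \<in> A"
    and diff: "x \<in> A \<Longrightarrow> y \<in> A \<Longrightarrow> x - y \<in> A"
    and mult: "x \<in> A \<Longrightarrow> y \<in> A \<Longrightarrow> x * y \<in> A"
begin

lemma zero: "0 \<in> A"
  using diff[OF one one] by simp

lemma uminus: "x \<in> A \<Longrightarrow> - x \<in> A"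
  using diff[OF zero, of x] by simp

lemma add: "x \<in> A \<Longrightarrow> y \<in> A \<Longrightarrow> x + y \<in> A"
  using diff[of x "- y"] uminus[of y] by simp

lemma sum: "(\<And>i. i \<in> S \<Longrightarrow> f i \<in> A) \<Longrightarrow> sum f S \<in> A"
  by (induction S rule: infinite_finite_induct) (auto intro: zero add)

lemma prod: "(\<And>i. i \<in> S \<Longrightarrow> f i \<in> A) \<Longrightarrow> prod f S \<in> A"
  by (induction S rule: infinite_finite_induct) (auto intro: one mult)

lemma power: "x \<in> A \<Longrightarrow> x ^ k \<in> A"
  by (induction k) (auto intro: one mult)

lemma of_nat: "of_nat k \<in> A"
  by (induction k) (auto intro: zero one add)

end

locale coeff_ideal = coeff_ring A for A :: "'a::field set" +
  fixes I :: "'a::field set"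
  assumes subset: "I \<subseteq> A"
    and ideal_zero: "0 \<in> I"
    and ideal_diff: "x \<in> I \<Longrightarrow> y \<in> I \<Longrightarrow> x - y \<in> I"
    and absorb: "a \<in> A \<Longrightarrow> x \<in> I \<Longrightarrow> a * x \<in> I"
begin

lemma absorb': "x \<in> I \<Longrightarrow> a \<in> A \<Longrightarrow> x * a \<in> I"
  using absorb[of a x] by (simp add: mult.commute)

lemma ideal_uminus: "x \<in> I \<Longrightarrow> - x \<in> I"
  using ideal_diff[OF ideal_zero, of x] by simp

lemma ideal_uminus_iff: "- x \<in> I \<longleftrightarrow> x \<in> I"
  using ideal_uminus[of x] ideal_uminus[of "- x"] by auto

lemma ideal_add: "x \<in> I \<Longrightarrow> y \<in> I \<Longrightarrow> x + y \<in> I"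
  using ideal_diff[of x "- y"] ideal_uminus[of y] by simp

lemma ideal_sum: "(\<And>i. i \<in> S \<Longrightarrow> f i \<in> I) \<Longrightarrow> sum f S \<in> I"
  by (induction S rule: infinite_finite_induct) (auto intro: ideal_zero ideal_add)

lemma cong_sym: "x - y \<in> I \<Longrightarrow> y - x \<in> I"
  using ideal_uminus[of "x - y"] by simp

lemma cong_trans: "x - y \<in> I \<Longrightarrow> y - z \<in> I \<Longrightarrow> x - z \<in> I"
  using ideal_add[of "x - y" "y - z"] by simp

lemma cong_mult:
  assumes "x - x' \<in> I" "y - y' \<in> I" "x' \<in> A" "y \<in> A"
  shows "x * y - x' * y' \<in> I"
proof -
  have "x * y - x' * y' = (x - x') * y + x' * (y - y')" by (simp add: algebra_simps)
  then show ?thesis using assms by (auto intro: ideal_add absorb absorb')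
qed

lemma cong_sum: "(\<And>i. i \<in> S \<Longrightarrow> f i - g i \<in> I) \<Longrightarrow> sum f S - sum g S \<in> I"
  by (simp flip: sum_subtractf add: ideal_sum)

lemma cong_prod:
  assumes "\<And>i. i \<in> S \<Longrightarrow> f i - g i \<in> I" "\<And>i. i \<in> S \<Longrightarrow> f i \<in> A" "\<And>i. i \<in> S \<Longrightarrow> g i \<in> A"
  shows "prod f S - prod g S \<in> I"
  using assms
  by (induction S rule: infinite_finite_induct) (auto intro!: ideal_zero cong_mult prod)

text \<open>The predicate under the choice depends only on the residue class of \<open>x\<close>, so
  congruent elements receive the same representative; the image of \<open>A\<close> under
  \<open>rep\<close> serves as the quotient ring.\<close>

definition rep :: "'a \<Rightarrow> 'a" where
  "rep x = (SOME y. y \<in> A \<and> x - y \<in> I)"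

lemma rep:
  assumes "x \<in> A"
  shows rep_closed: "rep x \<in> A" and rep_cong: "x - rep x \<in> I"
proof -
  have "rep x \<in> A \<and> x - rep x \<in> I"
    unfolding rep_def by (rule someI[of _ x]) (use assms ideal_zero in auto)
  then show "rep x \<in> A" "x - rep x \<in> I" by auto
qed

lemma rep_eq_iff:
  assumes "x \<in> A" "y \<in> A"
  shows "rep x = rep y \<longleftrightarrow> x - y \<in> I"
proof
  assume "rep x = rep y"
  then show "x - y \<in> I" using rep_cong[OF assms(1)] rep_cong[OF assms(2)] by (metis cong_sym cong_trans)
next
  assume "x - y \<in> I"
  then have "x - z \<in> I \<longleftrightarrow> y - z \<in> I" for z using cong_trans cong_sym by blast
  then show "rep x = rep y" unfolding rep_def by simp
qed

definition finite_index :: bool where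
  "finite_index \<longleftrightarrow> finite (rep ` A)"

lemma finite_indexI:
  assumes "finite T" "T \<subseteq> A" "\<And>x. x \<in> A \<Longrightarrow> \<exists>y\<in>T. x - y \<in> I"
  shows finite_index
proof -
  have "rep ` A \<subseteq> rep ` T"
  proof
    fix z assume "z \<in> rep ` A"
    then obtain x where x: "x \<in> A" "z = rep x" by auto
    then obtain y where "y \<in> T" "x - y \<in> I" using assms(3) by blast
    then show "z \<in> rep ` T" using x assms(2) rep_eq_iff[of x y] by auto
  qed
  then show ?thesis unfolding finite_index_def using assms(1) finite_surj by blast
qed

end

locale finite_prime = coeff_ideal A P for A P :: "'a::field set" +
  assumes proper: "1 \<notin> P"
    and prime: "x \<in> A \<Longrightarrow> y \<in> A \<Longrightarrow> x * y \<in> P \<Longrightarrow> x \<in> P \<or> y \<in> P"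
    and finite_index: "finite_index"
begin

lemma prime_power: "x \<in> A \<Longrightarrow> x ^ k \<in> P \<Longrightarrow> x \<in> P"
  by (induction k) (use proper prime power in auto)

text \<open>Two powers of \<open>c\<close> coincide in the finite residue ring; cancelling the
  smaller one, by primality, makes a power of \<open>c\<close> the inverse. The residue ring is thus
  a field.\<close>

lemma inverse_mod:
  assumes "c \<in> A" "c \<notin> P"
  obtains e where "e \<in> A" "e * c - 1 \<in> P"
proof -
  have "\<not> inj_on (\<lambda>k::nat. rep (c ^ k)) UNIV"
  proof
    assume "inj_on (\<lambda>k::nat. rep (c ^ k)) UNIV"
    moreover have "range (\<lambda>k::nat. rep (c ^ k)) \<subseteq> rep ` A" using power[OF assms(1)] by auto
    ultimately show False using finite_index unfolding finite_index_def
      by (meson finite_imageD finite_subset infinite_UNIV_nat)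
  qed
  then obtain i j :: nat where "i < j" and "rep (c ^ i) = rep (c ^ j)"
    unfolding inj_on_def by (metis linorder_neqE_nat)
  then have P: "c ^ i - c ^ j \<in> P" using rep_eq_iff power[OF assms(1)] by blast
  obtain k where k: "j = i + Suc k" using \<open>i < j\<close> less_iff_Suc_add by auto
  have "c ^ i * (1 - c ^ k * c) \<in> P" using P by (simp add: k power_add algebra_simps)
  moreover have "c ^ i \<notin> P" using assms prime_power by blast
  ultimately have "1 - c ^ k * c \<in> P" using prime[of "c ^ i" "1 - c ^ k * c"]
    by (auto intro: diff one mult power assms)
  then show ?thesis using that[of "c ^ k"] power[OF assms(1)] cong_sym by blast
qed

end

section \<open>Pseudo-division of polynomials over a subring\<close>

definition coeffs_in :: "'a::zero set \<Rightarrow> 'a poly \<Rightarrow> bool" where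
  "coeffs_in I f \<longleftrightarrow> (\<forall>i. coeff f i \<in> I)"

lemma coeffs_in_coeff: "coeffs_in I f \<Longrightarrow> coeff f i \<in> I"
  unfolding coeffs_in_def by simp

context coeff_ideal
begin

lemma coeffs_in_zero: "coeffs_in I 0"
  unfolding coeffs_in_def by (simp add: ideal_zero)

lemma coeffs_in_diff: "coeffs_in I f \<Longrightarrow> coeffs_in I g \<Longrightarrow> coeffs_in I (f - g)"
  unfolding coeffs_in_def by (simp add: ideal_diff)

lemma coeffs_in_add: "coeffs_in I f \<Longrightarrow> coeffs_in I g \<Longrightarrow> coeffs_in I (f + g)"
  unfolding coeffs_in_def by (simp add: ideal_add)

lemma coeffs_in_mult: "coeffs_in A f \<Longrightarrow> coeffs_in I g \<Longrightarrow> coeffs_in I (f * g)"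
  unfolding coeffs_in_def by (auto simp: coeff_mult intro!: ideal_sum absorb)

lemma coeffs_in_monom: "c \<in> I \<Longrightarrow> coeffs_in I (monom c n)"
  unfolding coeffs_in_def by (auto simp: ideal_zero)

lemma coeffs_in_smult: "c \<in> A \<Longrightarrow> coeffs_in I g \<Longrightarrow> coeffs_in I (smult c g)"
  unfolding coeffs_in_def by (auto intro: absorb)

text \<open>The leading coefficient of \<open>f\<close> need not be invertible in \<open>A\<close>,
  so each reduction step multiplies \<open>g\<close> by it instead of dividing. Keeping quotient and
  remainder over the ideal \<open>I\<close> serves both \<open>I = A\<close> and
  \<open>I = P\<close>.\<close>

lemma pseudo_division:
  assumes "f \<noteq> 0" "coeffs_in A f" "coeffs_in I g"
  shows "\<exists>k q r. coeffs_in I q \<and> coeffs_in I r \<and> smult (lead_coeff f ^ k) g = f * q + r \<and>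
    (r = 0 \<or> degree r < degree f)"
  using assms(3)
\<comment> \<open>The zero polynomial has degree 0 like the nonzero constants; the shifted measure
  puts it strictly below them.\<close>
proof (induction "if g = 0 then 0 else Suc (degree g)" arbitrary: g rule: less_induct)
  case less
  show ?case
  proof (cases "g = 0 \<or> degree g < degree f")
    case True
    then have "smult (lead_coeff f ^ 0) g = f * 0 + g" "g = 0 \<or> degree g < degree f" by auto
    then show ?thesis using less.prems coeffs_in_zero by blast
  next
    case False
    define c n h where "c = lead_coeff f" and "n = degree g - degree f" and
      "h = smult c g - f * monom (lead_coeff g) n"
    have cA: "c \<in> A" using assms(2) by (simp add: c_def coeffs_in_coeff)
    have mI: "coeffs_in I (monom (lead_coeff g) n)"
      by (rule coeffs_in_monom) (rule coeffs_in_coeff[OF less.prems])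
    have hI: "coeffs_in I h" unfolding h_def
      by (intro coeffs_in_diff coeffs_in_smult coeffs_in_mult assms mI less.prems cA)
    have "degree h \<le> degree g"
      unfolding h_def
    proof (intro degree_diff_le)
      show "degree (smult c g) \<le> degree g" by simp
      have "degree (f * monom (lead_coeff g) n) \<le> degree f + n"
        using degree_mult_le[of f "monom (lead_coeff g) n"] degree_monom_le[of "lead_coeff g" n] by linarith
      then show "degree (f * monom (lead_coeff g) n) \<le> degree g"
        using False by (simp add: n_def)
    qed
    moreover have "coeff h (degree g) = 0"
      using False by (simp add: h_def c_def n_def mult.commute[of f] coeff_monom_mult)
    ultimately have "h = 0 \<or> degree h < degree g" by (rule eq_zero_or_degree_less)
    then have "(if h = 0 then 0 else Suc (degree h)) < (if g = 0 then 0 else Suc (degree g))"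
      using False by auto
    from less.hyps[OF this hI] obtain k q r where
      qr: "coeffs_in I q" "coeffs_in I r" "smult (c ^ k) h = f * q + r" "r = 0 \<or> degree r < degree f"
      unfolding c_def by blast
    have "smult (c ^ Suc k) g = f * (q + smult (c ^ k) (monom (lead_coeff g) n)) + r"
      using qr(3) unfolding h_def by (simp add: algebra_simps smult_diff_right)
    moreover have "coeffs_in I (q + smult (c ^ k) (monom (lead_coeff g) n))"
      by (intro coeffs_in_add qr coeffs_in_smult mI power cA)
    ultimately show ?thesis using qr unfolding c_def by blast
  qed
qed

end

text \<open>\<open>A\<close> is an ideal of itself, so every statement about coefficients in an
  ideal also covers coefficients in \<open>A\<close>, under the prefix \<open>self\<close>.\<close>

sublocale coeff_ring \<subseteq> self: coeff_ideal A A
  by unfold_locales (auto intro: zero diff mult)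

section \<open>Adjoining one element to the coefficient ring\<close>

definition adjoin :: "'a::comm_ring_1 set \<Rightarrow> 'a \<Rightarrow> 'a set" where
  "adjoin A t = {poly f t | f. coeffs_in A f}"

lemma adjoinI: "coeffs_in A f \<Longrightarrow> poly f t \<in> adjoin A t"
  unfolding adjoin_def by blast

lemma (in coeff_ring) coeffs_in_const: "c \<in> A \<Longrightarrow> coeffs_in A [:c:]"
  unfolding coeffs_in_def by (auto simp: coeff_pCons zero split: nat.splits)

lemma (in coeff_ring) coeffs_in_X: "coeffs_in A [:0, 1:]"
  unfolding coeffs_in_def by (auto simp: coeff_pCons zero one split: nat.splits)

lemma (in coeff_ring) adjoin_superset: "c \<in> A \<Longrightarrow> c \<in> adjoin A t"
  using adjoinI[OF coeffs_in_const, of c t] by simp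

lemma (in coeff_ring) adjoin_generator: "t \<in> adjoin A t"
  using adjoinI[OF coeffs_in_X, of t] by simp

lemma (in coeff_ring) coeff_ring_adjoin: "coeff_ring (adjoin A t)"
proof
  show "1 \<in> adjoin A t" using adjoin_superset one by blast
next
  fix x y assume "x \<in> adjoin A t" "y \<in> adjoin A t"
  then obtain f g where "coeffs_in A f" "coeffs_in A g" "x = poly f t" "y = poly g t"
    unfolding adjoin_def by blast
  then show "x - y \<in> adjoin A t" "x * y \<in> adjoin A t"
    using adjoinI[OF self.coeffs_in_diff, of f g t] adjoinI[OF self.coeffs_in_mult, of f g t] by auto
qed

text \<open>The ideals above \<open>I\<close> are compared by how many of the finitely many
  representatives they contain, so a maximal proper one exists by counting, without Zorn's lemma. It
  is prime by the usual argument for maximal ideals.\<close>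

lemma (in coeff_ideal) ex_finite_prime_superset:
  assumes "1 \<notin> I" finite_index
  shows "\<exists>Q. finite_prime A Q \<and> I \<subseteq> Q"
proof -
  define T where "T = rep ` A"
  have T: "finite T" "T \<subseteq> A" using assms(2) rep_closed by (auto simp: T_def finite_index_def)
  let ?ok = "\<lambda>Q. coeff_ideal A Q \<and> I \<subseteq> Q \<and> 1 \<notin> Q"
  have "?ok I" using assms(1) coeff_ideal_axioms by blast
  moreover have "\<forall>Q. ?ok Q \<longrightarrow> card (Q \<inter> T) < Suc (card T)"
    using T by (auto simp: less_Suc_eq_le intro: card_mono)
  ultimately have "\<exists>Q. ?ok Q \<and> (\<forall>R. ?ok R \<longrightarrow> card (R \<inter> T) \<le> card (Q \<inter> T))"
    by (rule ex_has_greatest_nat[where P = ?ok and f = "\<lambda>Q. card (Q \<inter> T)"])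
  then obtain Q where Q: "?ok Q" and max: "\<And>R. ?ok R \<Longrightarrow> card (R \<inter> T) \<le> card (Q \<inter> T)"
    by blast
  interpret Q: coeff_ideal A Q using Q by blast
  have "finite_prime A Q"
  proof
    show "1 \<notin> Q" using Q by blast
    show "Q.finite_index"
    proof (rule Q.finite_indexI[OF T])
      fix x assume "x \<in> A"
      then show "\<exists>y\<in>T. x - y \<in> Q" using rep_cong Q by (auto simp: T_def)
    qed
  next
    fix x y assume xy: "x \<in> A" "y \<in> A" "x * y \<in> Q"
    show "x \<in> Q \<or> y \<in> Q"
    proof (rule ccontr)
      assume neg: "\<not> (x \<in> Q \<or> y \<in> Q)"
      \<comment> \<open>If neither factor is in \<open>Q\<close>, the ideal \<open>Q + A x\<close>
        is proper, since \<open>1 = q + a * x\<close> times \<open>y\<close> would put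
        \<open>y\<close> in \<open>Q\<close>; yet it contains one more representative, that of
        \<open>x\<close>.\<close>
      define R where "R = {q + a * x | q a. q \<in> Q \<and> a \<in> A}"
      have QR: "Q \<subseteq> R" unfolding R_def using zero by force
      have xR: "x \<in> R" unfolding R_def using one Q.ideal_zero by force
      interpret R: coeff_ideal A R
      proof
        show "R \<subseteq> A" unfolding R_def using Q.subset xy by (auto intro: add mult)
        show "0 \<in> R" using QR Q.ideal_zero by blast
      next
        fix u v assume "u \<in> R" "v \<in> R"
        then obtain p a q b where "p \<in> Q" "q \<in> Q" "a \<in> A" "b \<in> A" "u = p + a * x" "v = q + b * x"
          unfolding R_def by blast
        then have "u - v = (p - q) + (a - b) * x" "p - q \<in> Q" "a - b \<in> A"
          by (auto simp: algebra_simps intro: diff Q.ideal_diff)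
        then show "u - v \<in> R" unfolding R_def by blast
      next
        fix c u assume "c \<in> A" "u \<in> R"
        then obtain p a where "p \<in> Q" "a \<in> A" "u = p + a * x" unfolding R_def by blast
        then have "c * u = c * p + (c * a) * x" "c * p \<in> Q" "c * a \<in> A"
          using \<open>c \<in> A\<close> by (auto simp: algebra_simps intro: mult Q.absorb)
        then show "c * u \<in> R" unfolding R_def by blast
      qed
      have "1 \<notin> R"
      proof
        assume "1 \<in> R"
        then obtain q a where "q \<in> Q" "a \<in> A" and 1: "1 = q + a * x" unfolding R_def by blast
        have "y = (q + a * x) * y" by (simp flip: 1)
        also have "\<dots> = y * q + a * (x * y)" by (simp add: algebra_simps)
        also have "\<dots> \<in> Q" 
          using Q.absorb[OF xy(2) \<open>q \<in> Q\<close>] Q.absorb[OF \<open>a \<in> A\<close> xy(3)] by (rule Q.ideal_add)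
        finally show False using neg by blast
      qed
      then have "card (R \<inter> T) \<le> card (Q \<inter> T)" using max[of R] R.coeff_ideal_axioms Q QR by blast
      moreover have "Q \<inter> T \<subset> R \<inter> T"
      proof -
        have x_cong: "x - rep x \<in> Q" using rep_cong xy Q by blast
        have "rep x \<notin> Q" using Q.ideal_add[OF x_cong, of "rep x"] neg by auto
        moreover have "rep x \<in> R" using R.ideal_diff[OF xR, of "x - rep x"] x_cong QR by auto
        ultimately show ?thesis using QR xy by (auto simp: T_def)
      qed
      ultimately show False using psubset_card_mono[of "R \<inter> T" "Q \<inter> T"] T by simp
    qed
  qed
  then show ?thesis using Q by blast
qed

text \<open>Modulo \<open>P\<close> the leading coefficient of \<open>f\<close> is a unit, so
  \<open>f\<close> may be treated as monic, and the residue ring of \<open>adjoin A t\<close> is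
  spanned over the finite one of \<open>A\<close> by the powers of \<open>t\<close> below the degree
  of \<open>f\<close>.\<close>

lemma (in finite_prime) finite_index_adjoin:
  assumes f: "coeffs_in A f" "lead_coeff f \<notin> P"
    and J: "coeff_ideal (adjoin A t) J" "P \<subseteq> J" "poly f t \<in> J"
  shows "coeff_ideal.finite_index (adjoin A t) J"
proof -
  interpret B: coeff_ring "adjoin A t" by (rule coeff_ring_adjoin)
  interpret J: coeff_ideal "adjoin A t" J by (rule J)
  define c d where "c = lead_coeff f" and "d = degree f"
  have cA: "c \<in> A" using f by (simp add: c_def coeffs_in_coeff)
  obtain e where e: "e \<in> A" "e * c - 1 \<in> P" using inverse_mod f cA unfolding c_def by metis
  have ec: "(e * c) ^ k - 1 \<in> P" for k
  proof (induction k)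
    case (Suc k)
    then show ?case using cong_mult[OF e(2) Suc, of] by (simp add: one power mult e cA)
  qed (simp add: ideal_zero)
  have f0: "f \<noteq> 0" using f ideal_zero by auto
  define T where "T = (\<lambda>u. \<Sum>i<d. u i * t ^ i) ` ({..<d} \<rightarrow>\<^sub>E rep ` A)"
  have sum_closed: "(\<Sum>i<d. u i * t ^ i) \<in> adjoin A t" if "\<And>i. i < d \<Longrightarrow> u i \<in> A" for u
    using that by (intro B.sum B.mult B.power adjoin_superset adjoin_generator) auto
  show ?thesis
  proof (rule J.finite_indexI)
    have "finite ({..<d} \<rightarrow>\<^sub>E rep ` A)"
      using finite_index unfolding finite_index_def by (simp add: finite_PiE)
    then show "finite T" unfolding T_def by (rule finite_imageI)
    show "T \<subseteq> adjoin A t"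
      unfolding T_def
    proof (rule image_subsetI, rule sum_closed)
      fix u i assume "u \<in> {..<d} \<rightarrow>\<^sub>E rep ` A" "i < d"
      then show "u i \<in> A" using rep_closed by (auto dest!: PiE_mem[of _ _ _ i])
    qed
  next
    fix x assume "x \<in> adjoin A t"
    then obtain g where g: "coeffs_in A g" "x = poly g t" unfolding adjoin_def by blast
    obtain k q r where qr: "coeffs_in A q" "coeffs_in A r" "smult (c ^ k) g = f * q + r"
      "r = 0 \<or> degree r < d"
      using self.pseudo_division[OF f0 f(1) g(1)] unfolding c_def d_def by blast
    have r_sum: "poly r t = (\<Sum>i<d. coeff r i * t ^ i)"
    proof (cases "r = 0")
      case False
      then have "degree r < d" using qr(4) by simp
      then show ?thesis unfolding poly_altdef
        by (intro sum.mono_neutral_left) (auto simp: coeff_eq_0)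
    qed simp
    define u where "u = (\<lambda>i\<in>{..<d}. rep (e ^ k * coeff r i))"
    have rA: "e ^ k * coeff r i \<in> A" for i using e qr by (intro mult power coeffs_in_coeff)
    have "c ^ k * x - poly r t = poly q t * poly f t"
      using arg_cong[OF qr(3), of "\<lambda>p. poly p t"] g by (simp add: algebra_simps)
    also have "\<dots> \<in> J" by (rule J.absorb[OF adjoinI[OF qr(1)] J(3)])
    finally have 1: "e ^ k * (c ^ k * x - poly r t) \<in> J"
      by (rule J.absorb[OF adjoin_superset[OF power[OF e(1)]]])
    have 2: "x * ((e * c) ^ k - 1) \<in> J"
      by (rule J.absorb[OF \<open>x \<in> adjoin A t\<close>]) (use ec J(2) in blast)
    \<comment> \<open>Pseudo-division only controls \<open>c ^ k * x\<close>; multiplying by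
      \<open>e ^ k\<close> undoes this up to \<open>(e * c) ^ k - 1\<close>, which lies in
      \<open>P\<close>.\<close>
    have "x - e ^ k * poly r t = e ^ k * (c ^ k * x - poly r t) - x * ((e * c) ^ k - 1)"
      by (simp add: algebra_simps power_mult_distrib)
    also have "\<dots> \<in> J" using 1 2 by (rule J.ideal_diff)
    finally have 3: "x - e ^ k * poly r t \<in> J" .
    have "e ^ k * poly r t = (\<Sum>i<d. (e ^ k * coeff r i) * t ^ i)"
      unfolding r_sum by (simp add: sum_distrib_left mult.assoc)
    also have "\<dots> - (\<Sum>i<d. u i * t ^ i) \<in> J"
    proof (rule J.cong_sum)
      fix i assume "i \<in> {..<d}"
      have "(e ^ k * coeff r i - rep (e ^ k * coeff r i)) * t ^ i \<in> J"
        by (rule J.absorb'[OF subsetD[OF J(2) rep_cong[OF rA]] B.power[OF adjoin_generator]])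
      then show "e ^ k * coeff r i * t ^ i - u i * t ^ i \<in> J"
        using \<open>i \<in> {..<d}\<close> by (simp add: u_def left_diff_distrib)
    qed
    finally have "x - (\<Sum>i<d. u i * t ^ i) \<in> J" using 3 J.cong_trans by blast
    moreover have "(\<Sum>i<d. u i * t ^ i) \<in> T"
      unfolding T_def u_def using rA by (intro imageI PiE_I) auto
    ultimately show "\<exists>y\<in>T. x - y \<in> J" by blast
  qed
qed

text \<open>Rabinowitsch's trick: modulo a prime ideal containing \<open>P\<close> and
  \<open>t * poly g t - 1\<close>, the element \<open>poly g t\<close> is a unit. Transcendence
  turns equations in \<open>adjoin A t\<close> into equations between polynomials, so that
  properness can be read off from coefficients.\<close>

lemma (in finite_prime) finite_prime_adjoin_transcendental:
  assumes trans: "\<And>f. coeffs_in A f \<Longrightarrow> poly f t = 0 \<Longrightarrow> f = 0"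
    and g: "coeffs_in A g" "lead_coeff g \<notin> P"
  shows "\<exists>Q. finite_prime (adjoin A t) Q \<and> poly g t \<notin> Q"
proof -
  interpret B: coeff_ring "adjoin A t" by (rule coeff_ring_adjoin)
  have g0: "g \<noteq> 0" using g ideal_zero by auto
  define f where "f = pCons (- 1) g"
  have lc_f: "lead_coeff f = lead_coeff g" and deg_f: "degree f = Suc (degree g)"
    unfolding f_def using g0 by auto
  have f: "coeffs_in A f" unfolding f_def coeffs_in_def
    using g(1) by (auto simp: coeff_pCons coeffs_in_def uminus one split: nat.splits)
  have f_eq: "poly f t = t * poly g t - 1" by (simp add: f_def)
  define J where "J = {poly u t + poly f t * poly h t | u h. coeffs_in P u \<and> coeffs_in A h}"
  have subA: "coeffs_in P u \<Longrightarrow> coeffs_in A u" for u using subset unfolding coeffs_in_def by blast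
  interpret J: coeff_ideal "adjoin A t" J
  proof
    show "J \<subseteq> adjoin A t" unfolding J_def using subA f
      by (auto intro!: B.add B.mult adjoinI)
    show "0 \<in> J" unfolding J_def using coeffs_in_zero self.coeffs_in_zero by force
  next
    fix x y assume "x \<in> J" "y \<in> J"
    then obtain u h v k where uh: "coeffs_in P u" "coeffs_in A h" "coeffs_in P v" "coeffs_in A k"
      and xy: "x = poly u t + poly f t * poly h t" "y = poly v t + poly f t * poly k t"
      unfolding J_def by blast
    have "x - y = poly (u - v) t + poly f t * poly (h - k) t" by (simp add: xy algebra_simps)
    then show "x - y \<in> J" unfolding J_def using uh coeffs_in_diff self.coeffs_in_diff by blast
  next
    fix z x assume "z \<in> adjoin A t" "x \<in> J"
    then obtain w u h where uh: "coeffs_in A w" "coeffs_in P u" "coeffs_in A h"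
      and xz: "z = poly w t" "x = poly u t + poly f t * poly h t"
      unfolding J_def adjoin_def by blast
    have "z * x = poly (w * u) t + poly f t * poly (w * h) t" by (simp add: xz algebra_simps)
    then show "z * x \<in> J" unfolding J_def using uh coeffs_in_mult self.coeffs_in_mult by blast
  qed
  have fJ: "poly f t \<in> J" 
    unfolding J_def using coeffs_in_zero coeffs_in_const[OF one] by (intro CollectI exI[of _ 0] exI[of _ "[:1:]"]) auto
  have PJ: "P \<subseteq> J"
  proof
    fix x assume "x \<in> P"
    then have "coeffs_in P (monom x 0)" by (rule coeffs_in_monom)
    then show "x \<in> J" unfolding J_def using self.coeffs_in_zero
      by (intro CollectI exI[of _ "monom x 0"] exI[of _ 0]) (auto simp: poly_monom)
  qed
  have "1 \<notin> J"
  proof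
    assume "1 \<in> J"
    then obtain u h where uh: "coeffs_in P u" "coeffs_in A h" "1 = poly u t + poly f t * poly h t"
      unfolding J_def by blast
    have "coeffs_in A ([:1:] - (u + f * h))"
      by (intro self.coeffs_in_diff self.coeffs_in_add self.coeffs_in_mult coeffs_in_const one uh f subA)
    moreover have "poly ([:1:] - (u + f * h)) t = 0" using uh by simp
    ultimately have eq: "[:1:] - (u + f * h) = 0" using trans by blast
    then have coeff_fh: "coeff (f * h) i = coeff [:1:] i - coeff u i" for i
      by (metis add_diff_cancel_left' coeff_diff right_minus_eq)
    \<comment> \<open>Modulo \<open>P\<close>, the polynomial \<open>f * h\<close> would be the
      constant 1, while \<open>f\<close> has positive degree and a leading coefficient outside
      \<open>P\<close>. The last coefficient of \<open>h\<close> outside \<open>P\<close> gives the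
      contradiction.\<close>
    let ?N = "{j. coeff h j \<notin> P}"
    have fin: "finite ?N" using ideal_zero
      by (intro finite_subset[OF _ finite_atMost[of "degree h"]]) (auto intro: le_degree)
    have "?N \<noteq> {}"
    proof
      assume "?N = {}"
      then have "coeffs_in P (f * h)" using f by (intro coeffs_in_mult) (auto simp: coeffs_in_def)
      then have "coeffs_in P (u + f * h)" using uh by (intro coeffs_in_add)
      moreover have "u + f * h = [:1:]" using eq by (metis right_minus_eq)
      ultimately have "coeff [:1:] 0 \<in> P" by (metis coeffs_in_coeff)
      then show False using proper by simp
    qed
    define j where "j = Max ?N"
    have j: "coeff h j \<notin> P" and jmax: "\<And>i. i > j \<Longrightarrow> coeff h i \<in> P"
      using Max_in[OF fin \<open>?N \<noteq> {}\<close>] Max_ge[OF fin] unfolding j_def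
      by (auto dest: leD)
    \<comment> \<open>In this positive degree the only term not forced into \<open>P\<close> is the
      product of the leading coefficients of \<open>f\<close> and \<open>h\<close> modulo
      \<open>P\<close>.\<close>
    let ?m = "degree f + j"
    have "coeff (f * h) ?m \<in> P"
      using coeffs_in_coeff[OF uh(1), of ?m] by (simp add: coeff_fh deg_f ideal_uminus)
    moreover have "coeff (f * h) ?m = coeff f (degree f) * coeff h j +
        (\<Sum>i\<in>{..?m} - {degree f}. coeff f i * coeff h (?m - i))"
      unfolding coeff_mult by (subst sum.remove[of _ "degree f"]) auto
    moreover have "(\<Sum>i\<in>{..?m} - {degree f}. coeff f i * coeff h (?m - i)) \<in> P"
    proof (rule ideal_sum)
      fix i assume i: "i \<in> {..?m} - {degree f}"
      show "coeff f i * coeff h (?m - i) \<in> P"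
      proof (cases "i < degree f")
        case True
        then show ?thesis using f by (intro absorb jmax coeffs_in_coeff) auto
      next
        case False
        then show ?thesis using i by (simp add: coeff_eq_0 ideal_zero)
      qed
    qed
    ultimately have "coeff f (degree f) * coeff h j \<in> P" using ideal_diff by fastforce
    then show False
      using prime[OF coeffs_in_coeff[OF f, of "degree f"] coeffs_in_coeff[OF uh(2), of j]] j lc_f g(2)
      by argo
  qed
  moreover have "J.finite_index"
    by (rule finite_index_adjoin[OF f _ J.coeff_ideal_axioms PJ fJ]) (simp only: lc_f g not_False_eq_True)
  ultimately obtain Q where Q: "finite_prime (adjoin A t) Q" "J \<subseteq> Q"
    using J.ex_finite_prime_superset by blast
  interpret Q: finite_prime "adjoin A t" Q by (rule Q)
  have "poly g t \<notin> Q"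
  proof
    assume "poly g t \<in> Q"
    then have "t * poly g t \<in> Q" by (rule Q.absorb[OF adjoin_generator])
    moreover have "t * poly g t - 1 \<in> Q" using fJ Q(2) unfolding f_eq by blast
    ultimately show False using Q.ideal_diff[of "t * poly g t" "t * poly g t - 1"] Q.proper by simp
  qed
  then show ?thesis using Q by blast
qed

text \<open>Replaces the norm: among the nonzero polynomials of degree below that of
  \<open>f\<close> whose value at \<open>t\<close> is a multiple of \<open>b\<close>, one of least
  degree is constant, because dividing \<open>f\<close> by it would otherwise give a smaller one or
  a nonzero polynomial of degree below that of \<open>f\<close> vanishing at
  \<open>t\<close>.\<close>

lemma (in coeff_ring) algebraic_multiple_in_base:
  assumes f: "coeffs_in A f" "f \<noteq> 0" "poly f t = 0"
    and min: "\<And>h. coeffs_in A h \<Longrightarrow> degree h < degree f \<Longrightarrow> poly h t = 0 \<Longrightarrow> h = 0"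
    and b: "b \<in> adjoin A t" "b \<noteq> 0"
  shows "\<exists>z\<in>adjoin A t. b * z \<in> A \<and> b * z \<noteq> 0"
proof -
  interpret B: coeff_ring "adjoin A t" by (rule coeff_ring_adjoin)
  let ?ok = "\<lambda>h. coeffs_in A h \<and> h \<noteq> 0 \<and> degree h < degree f \<and> (\<exists>z\<in>adjoin A t. poly h t = b * z)"
  obtain g where g: "coeffs_in A g" "b = poly g t" using b unfolding adjoin_def by blast
  obtain k q r where qr: "coeffs_in A q" "coeffs_in A r" "smult (lead_coeff f ^ k) g = f * q + r"
    "r = 0 \<or> degree r < degree f"
    using self.pseudo_division[OF f(2,1) g(1)] by blast
  have r_eq: "poly r t = b * lead_coeff f ^ k"
    using arg_cong[OF qr(3), of "\<lambda>p. poly p t"] g f by (simp add: mult.commute)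
  then have "r \<noteq> 0" using b f by auto
  then have "?ok r" using r_eq qr adjoin_superset[OF power[OF coeffs_in_coeff[OF f(1)]]] by blast
  then obtain h where h: "?ok h" and hmin: "\<And>h'. ?ok h' \<Longrightarrow> degree h \<le> degree h'"
    using arg_min_nat_lemma[of ?ok r degree] by blast
  obtain z where z: "z \<in> adjoin A t" "poly h t = b * z" using h by blast
  obtain k q r where qr: "coeffs_in A q" "coeffs_in A r" "smult (lead_coeff h ^ k) f = h * q + r"
    "r = 0 \<or> degree r < degree h"
    using self.pseudo_division[of h f] h f by blast
  have ht: "poly h t \<noteq> 0" using h min by blast
  have eq: "0 = poly h t * poly q t + poly r t"
    using arg_cong[OF qr(3), of "\<lambda>p. poly p t"] f by simp
  have "degree h = 0"
  proof (cases "r = 0")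
    case True
    then have "poly q t = 0" using eq ht by simp
    have "smult (lead_coeff h ^ k) f \<noteq> 0" using h f by simp
    then have "q \<noteq> 0" using qr(3) True by auto
    have "degree f = degree h + degree q"
      using arg_cong[OF qr(3), of degree] True h \<open>q \<noteq> 0\<close> by (simp add: degree_mult_eq)
    then show ?thesis using min[OF qr(1)] \<open>poly q t = 0\<close> \<open>q \<noteq> 0\<close> by auto
  next
    case False
    have "poly r t = b * (- (z * poly q t))" using eq z by (simp add: eq_neg_iff_add_eq_0 algebra_simps)
    moreover have "- (z * poly q t) \<in> adjoin A t" by (intro B.uminus B.mult z adjoinI qr)
    ultimately have "\<exists>z\<in>adjoin A t. poly r t = b * z" by blast
    moreover have "degree r < degree h" "degree h < degree f" using False qr h by auto
    ultimately have "?ok r" using False qr(2) by simp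
    then show ?thesis using hmin[of r] qr False by auto
  qed
  then obtain c where c: "h = [:c:]" by (metis degree_eq_zeroE)
  then have "b * z = c" "c \<noteq> 0" "c \<in> A" using z h coeffs_in_coeff[of A h 0] by auto
  then show ?thesis using z by blast
qed

text \<open>Lying over. Integrality of \<open>t\<close> is replaced by a leading coefficient that is
  a unit modulo \<open>P\<close>; minimality of the degree of \<open>f\<close> prevents the extended
  ideal from being everything.\<close>

lemma (in finite_prime) finite_prime_adjoin_algebraic:
  assumes f: "coeffs_in A f" "lead_coeff f \<notin> P" "poly f t = 0"
    and min: "\<And>h. coeffs_in A h \<Longrightarrow> degree h < degree f \<Longrightarrow> poly h t = 0 \<Longrightarrow> h = 0"
  shows "\<exists>Q. finite_prime (adjoin A t) Q \<and> P \<subseteq> Q"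
proof -
  interpret B: coeff_ring "adjoin A t" by (rule coeff_ring_adjoin)
  have subA: "coeffs_in P u \<Longrightarrow> coeffs_in A u" for u using subset unfolding coeffs_in_def by blast
  have f0: "f \<noteq> 0" using f ideal_zero by auto
  have mult_notin: "x * y \<in> A \<and> x * y \<notin> P" if "x \<in> A \<and> x \<notin> P" "y \<in> A \<and> y \<notin> P" for x y
    using that prime mult by blast
  \<comment> \<open>The elements that fall into the extension of \<open>P\<close> after localising
    at \<open>P\<close>; the factors \<open>s\<close> are the denominators.\<close>
  define J where "J = {x \<in> adjoin A t. \<exists>s u. (s \<in> A \<and> s \<notin> P) \<and> coeffs_in P u \<and> s * x = poly u t}"
  interpret J: coeff_ideal "adjoin A t" J
  proof
    show "J \<subseteq> adjoin A t" unfolding J_def by blast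
    have "1 * 0 = poly (0 :: 'a poly) t" by simp
    then show "0 \<in> J" unfolding J_def using B.zero one proper coeffs_in_zero by blast
  next
    fix x y assume "x \<in> J" "y \<in> J"
    then obtain s u s' u' where su: "s \<in> A \<and> s \<notin> P" "coeffs_in P u" "s * x = poly u t"
      and su': "s' \<in> A \<and> s' \<notin> P" "coeffs_in P u'" "s' * y = poly u' t"
      and xy: "x \<in> adjoin A t" "y \<in> adjoin A t"
      unfolding J_def by blast
    have "(s * s') * (x - y) = s' * (s * x) - s * (s' * y)" by (simp add: algebra_simps)
    also have "\<dots> = poly (smult s' u - smult s u') t" by (simp only: su su' poly_diff poly_smult)
    finally have eq: "(s * s') * (x - y) = poly (smult s' u - smult s u') t" .
    have "coeffs_in P (smult s' u - smult s u')"
      using su su' by (intro coeffs_in_diff coeffs_in_smult) auto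
    then show "x - y \<in> J" using eq mult_notin[OF su(1) su'(1)] B.diff[OF xy] unfolding J_def by blast
  next
    fix z x assume z: "z \<in> adjoin A t" and "x \<in> J"
    then obtain w s u where w: "coeffs_in A w" "z = poly w t"
      and su: "s \<in> A \<and> s \<notin> P" "coeffs_in P u" "s * x = poly u t" and x: "x \<in> adjoin A t"
      unfolding J_def adjoin_def by blast
    have "s * (z * x) = poly (w * u) t" using su w by (simp add: algebra_simps)
    then show "z * x \<in> J" using su coeffs_in_mult[OF w(1) su(2)] B.mult[OF z x] unfolding J_def by blast
  qed
  have PJ: "P \<subseteq> J"
  proof
    fix x assume "x \<in> P"
    then have "coeffs_in P (monom x 0)" "1 * x = poly (monom x 0) t"
      by (auto intro: coeffs_in_monom simp: poly_monom)
    then show "x \<in> J" using one proper adjoin_superset \<open>x \<in> P\<close> subset unfolding J_def by blast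
  qed
  have "1 \<notin> J"
  proof
    assume "1 \<in> J"
    then obtain s u where su: "s \<in> A" "s \<notin> P" "coeffs_in P u" "s = poly u t"
      unfolding J_def by auto
    define c where "c = lead_coeff f"
    have c: "c \<in> A" "c \<notin> P" using f by (auto simp: c_def coeffs_in_coeff)
    obtain k q r where qr: "coeffs_in P r" "smult (c ^ k) u = f * q + r"
      "r = 0 \<or> degree r < degree f"
      using pseudo_division[OF f0 f(1) su(3)] unfolding c_def by blast
    have "poly r t = c ^ k * s" using arg_cong[OF qr(2), of "\<lambda>p. poly p t"] f su by simp
    moreover have "degree f \<noteq> 0"
    proof
      assume "degree f = 0"
      then obtain a where "f = [:a:]" by (metis degree_eq_zeroE)
      then show False using f f0 by simp
    qed
    \<comment> \<open>This polynomial has smaller degree than \<open>f\<close> and vanishes at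
      \<open>t\<close>, so \<open>r\<close> is the constant \<open>c ^ k * s\<close>, which would
      then lie in \<open>P\<close>.\<close>
    ultimately have "r - [:c ^ k * s:] = 0"
      using qr(3) su c subA[OF qr(1)]
      by (intro min self.coeffs_in_diff coeffs_in_const mult power) (auto intro: degree_diff_less)
    then have "r = [:c ^ k * s:]" by (simp only: right_minus_eq)
    then have "c ^ k * s \<in> P" using coeffs_in_coeff[OF qr(1), of 0] by simp
    then have "c ^ k \<in> P" using prime su c power by blast
    then show False using c prime_power by blast
  qed
  moreover have "J.finite_index"
    by (rule finite_index_adjoin[OF f(1,2) J.coeff_ideal_axioms PJ]) (simp add: f(3) J.ideal_zero)
  ultimately obtain Q where "finite_prime (adjoin A t) Q" "J \<subseteq> Q"
    using J.ex_finite_prime_superset by blast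
  then show ?thesis using PJ by blast
qed

text \<open>The inductive step of the Nullstellensatz: the single element \<open>a\<close> collects
  everything that a prime ideal of \<open>A\<close> must avoid in order to yield one of
  \<open>adjoin A t\<close> avoiding \<open>b\<close>.\<close>

lemma (in coeff_ring) ex_finite_prime_adjoin:
  assumes b: "b \<in> adjoin A t" "b \<noteq> 0"
  shows "\<exists>a\<in>A. a \<noteq> 0 \<and> (\<forall>P. finite_prime A P \<longrightarrow> a \<notin> P \<longrightarrow>
    (\<exists>Q. finite_prime (adjoin A t) Q \<and> b \<notin> Q))"
proof (cases "\<forall>f. coeffs_in A f \<longrightarrow> poly f t = 0 \<longrightarrow> f = 0")
  case True
  obtain g where g: "coeffs_in A g" "b = poly g t" using b unfolding adjoin_def by blast
  have "lead_coeff g \<noteq> 0" using g b by auto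
  moreover have "\<exists>Q. finite_prime (adjoin A t) Q \<and> b \<notin> Q"
    if "finite_prime A P" "lead_coeff g \<notin> P" for P
    using finite_prime.finite_prime_adjoin_transcendental[OF that(1) _ g(1) that(2), of t] True g(2) by blast
  ultimately show ?thesis using coeffs_in_coeff[OF g(1)] by blast
next
  case False
  let ?ok = "\<lambda>f. coeffs_in A f \<and> poly f t = 0 \<and> f \<noteq> 0"
  from False obtain f0 where "?ok f0" by blast
  then obtain f where f: "?ok f" and fmin: "\<And>h. ?ok h \<Longrightarrow> degree f \<le> degree h"
    using arg_min_nat_lemma[of ?ok f0 degree] by blast
  have min: "h = 0" if "coeffs_in A h" "degree h < degree f" "poly h t = 0" for h
    using fmin[of h] that by auto
  obtain z where z: "z \<in> adjoin A t" "b * z \<in> A" "b * z \<noteq> 0"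
    using algebraic_multiple_in_base[of f t b] f min b by blast
  \<comment> \<open>Avoiding \<open>lead_coeff f\<close> allows \<open>P\<close> to be extended;
    \<open>b * z\<close>, a nonzero multiple of \<open>b\<close> in \<open>A\<close>, stays a unit
    modulo the extension and so keeps \<open>b\<close> out of it.\<close>
  define a where "a = lead_coeff f * (b * z)"
  have "a \<in> A" "a \<noteq> 0" using f z by (auto simp: a_def intro: mult coeffs_in_coeff)
  moreover have "\<exists>Q. finite_prime (adjoin A t) Q \<and> b \<notin> Q" if "finite_prime A P" "a \<notin> P" for P
  proof -
    interpret P: finite_prime A P by fact
    have "lead_coeff f \<notin> P" "b * z \<notin> P"
      using that(2) f z P.absorb P.absorb' coeffs_in_coeff[of A f] unfolding a_def by blast+
    then obtain Q where Q: "finite_prime (adjoin A t) Q" "P \<subseteq> Q"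
      using P.finite_prime_adjoin_algebraic[of f t] f min by blast
    interpret Q: finite_prime "adjoin A t" Q by (rule Q)
    obtain e where e: "e \<in> A" "e * (b * z) - 1 \<in> P" 
      by (rule P.inverse_mod[OF z(2) \<open>b * z \<notin> P\<close>])
    have "b \<notin> Q"
    proof
      assume "b \<in> Q"
      then have "e * (b * z) \<in> Q" 
        by (intro Q.absorb[OF adjoin_superset[OF e(1)]] Q.absorb'[OF _ z(1)])
      then show False using Q.ideal_diff[of "e * (b * z)" "e * (b * z) - 1"] e Q Q.proper by auto
    qed
    then show ?thesis using Q by blast
  qed
  ultimately show ?thesis by blast
qed

section \<open>Base case: the subring generated by 1\<close>

lemma finite_prime_zero:
  assumes "coeff_ring A" "finite A"
  shows "finite_prime A {0}"
proof -
  interpret coeff_ring A by fact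
  interpret I: coeff_ideal A "{0}" by unfold_locales (auto intro: zero)
  show ?thesis by unfold_locales (use assms in \<open>auto simp: I.finite_index_def\<close>)
qed

lemma coeff_ring_of_int: "coeff_ring (range of_int)"
proof
  show "1 \<in> range of_int" by (metis of_int_1 rangeI)
  fix x y :: 'a assume "x \<in> range of_int" "y \<in> range of_int"
  then show "x - y \<in> range of_int" "x * y \<in> range of_int"
    by (auto simp flip: of_int_diff of_int_mult)
qed

text \<open>In positive characteristic the subring is finite and its zero ideal serves; in
  characteristic zero it is a copy of the integers, and any prime exceeding the absolute value of
  the integer \<open>b\<close> does not divide it.\<close>

lemma ex_finite_prime_of_int:
  assumes "b \<in> range of_int" "(b::'a::field) \<noteq> 0"
  shows "\<exists>P. finite_prime (range of_int) P \<and> b \<notin> P"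
proof (cases "\<exists>k>0. (of_nat k :: 'a) = 0")
  case True
  then obtain k where k: "k > 0" "(of_nat k :: 'a) = 0" by blast
  have "range (of_int :: int \<Rightarrow> 'a) \<subseteq> of_int ` {0..<int k}"
  proof
    fix x :: 'a assume "x \<in> range of_int"
    then obtain i where i: "x = of_int i" by blast
    have "(of_int (int k * (i div int k) + i mod int k) :: 'a) = of_int (i mod int k)"
      using k(2) by (simp only: of_int_add of_int_mult of_int_of_nat_eq) simp
    then have "x = of_int (i mod int k)" by (simp add: i)
    then show "x \<in> of_int ` {0..<int k}" using k(1) by auto
  qed
  then have "finite (range (of_int :: int \<Rightarrow> 'a))" using finite_surj by blast
  then show ?thesis using finite_prime_zero[OF coeff_ring_of_int] assms(2) by blast
next
  case False
  have inj: "(of_int i :: 'a) = of_int j \<longleftrightarrow> i = j" for i j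
  proof -
    have "i = 0" if "(of_int i :: 'a) = 0" for i
      using that False by (cases i rule: int_cases2) auto
    from this[of "i - j"] show ?thesis by auto
  qed
  obtain z where z: "b = of_int z" using assms(1) by (rule rangeE)
  obtain p :: nat where p: "prime p" "nat \<bar>z\<bar> < p" using bigger_prime[of "nat \<bar>z\<bar>"] by auto
  interpret coeff_ring "range (of_int :: int \<Rightarrow> 'a)" by (rule coeff_ring_of_int)
  define P where "P = (of_int :: int \<Rightarrow> 'a) ` {i. int p dvd i}"
  have P_iff: "of_int i \<in> P \<longleftrightarrow> int p dvd i" for i unfolding P_def by (auto simp: inj)
  interpret I: coeff_ideal "range (of_int :: int \<Rightarrow> 'a)" P
  proof
    show "P \<subseteq> range of_int" unfolding P_def by blast
    show "0 \<in> P" using P_iff[of 0] by simp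
  next
    fix x y assume "x \<in> P" "y \<in> P"
    then obtain i j where "x = of_int i" "y = of_int j" "int p dvd i" "int p dvd j" unfolding P_def by blast
    then show "x - y \<in> P" using P_iff[of "i - j"] by simp
  next
    fix a x :: 'a assume "a \<in> range of_int" "x \<in> P"
    then obtain i j where "a = of_int i" "x = of_int j" "int p dvd j" unfolding P_def by blast
    then show "a * x \<in> P" using P_iff[of "i * j"] by simp
  qed
  have "finite_prime (range (of_int :: int \<Rightarrow> 'a)) P"
  proof
    show "1 \<notin> P" using P_iff[of 1] p(1) not_prime_1 by auto
    show "I.finite_index"
    proof (rule I.finite_indexI)
      show "finite (of_int ` {0..<int p} :: 'a set)" by simp
      fix x :: 'a assume "x \<in> range of_int"
      then obtain i where i: "x = of_int i" by blast
      have "x - of_int (i mod int p) \<in> P"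
        using P_iff[of "i - i mod int p"] by (simp add: i)
      moreover have "of_int (i mod int p) \<in> (of_int ` {0..<int p} :: 'a set)"
        using prime_gt_0_nat[OF p(1)] by (intro imageI) auto
      ultimately show "\<exists>y\<in>of_int ` {0..<int p}. x - y \<in> P" by blast
    qed auto
  next
    fix x y :: 'a assume "x \<in> range of_int" "y \<in> range of_int" "x * y \<in> P"
    then obtain i j where ij: "x = of_int i" "y = of_int j" by blast
    then have "int p dvd i * j" using \<open>x * y \<in> P\<close> P_iff[of "i * j"] by simp
    then show "x \<in> P \<or> y \<in> P" using p(1) by (simp add: ij P_iff prime_dvd_mult_iff)
  qed
  moreover have "b \<notin> P"
  proof
    assume "b \<in> P"
    then have "int p dvd z" by (simp add: z P_iff)
    moreover have "z \<noteq> 0" using assms z by auto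
    ultimately have "int p \<le> \<bar>z\<bar>" using dvd_imp_le_int[of z "int p"] by simp
    then show False using p(2) by linarith
  qed
  ultimately show ?thesis by blast
qed

text \<open>The consequence of the Nullstellensatz over \<open>\<int>\<close> on which everything rests.\<close>

theorem ex_coeff_ring_finite_primes:
  assumes "finite S"
  shows "\<exists>A. coeff_ring A \<and> S \<subseteq> A \<and> (\<forall>b\<in>A. b \<noteq> 0 \<longrightarrow> (\<exists>P. finite_prime A P \<and> b \<notin> P))"
  using assms
proof (induction S)
  case empty
  have "coeff_ring (range (of_int :: int \<Rightarrow> 'a)) \<and> {} \<subseteq> range (of_int :: int \<Rightarrow> 'a) \<and>
      (\<forall>b\<in>range (of_int :: int \<Rightarrow> 'a). b \<noteq> 0 \<longrightarrow> (\<exists>P. finite_prime (range of_int) P \<and> b \<notin> P))"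
    by (intro conjI ballI impI empty_subsetI coeff_ring_of_int) (rule ex_finite_prime_of_int)
  then show ?case by (rule exI)
next
  case (insert t S)
  from insert.IH obtain A where A: "coeff_ring A \<and> S \<subseteq> A \<and>
      (\<forall>b\<in>A. b \<noteq> 0 \<longrightarrow> (\<exists>P. finite_prime A P \<and> b \<notin> P))" by (elim exE)
  then interpret coeff_ring A by (elim conjE)
  have "\<exists>Q. finite_prime (adjoin A t) Q \<and> b \<notin> Q" if b: "b \<in> adjoin A t" "b \<noteq> 0" for b
  proof -
    obtain a where a: "a \<in> A" "a \<noteq> 0" "\<forall>P. finite_prime A P \<longrightarrow> a \<notin> P \<longrightarrow>
        (\<exists>Q. finite_prime (adjoin A t) Q \<and> b \<notin> Q)"
      using ex_finite_prime_adjoin[OF b] by (elim bexE conjE)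
    moreover obtain P where "finite_prime A P" "a \<notin> P" using A a(1,2) by (elim conjE) fast
    ultimately show ?thesis by simp
  qed
  moreover have "insert t S \<subseteq> adjoin A t" using A adjoin_superset adjoin_generator by auto
  ultimately have "coeff_ring (adjoin A t) \<and> insert t S \<subseteq> adjoin A t \<and>
      (\<forall>b\<in>adjoin A t. b \<noteq> 0 \<longrightarrow> (\<exists>P. finite_prime (adjoin A t) P \<and> b \<notin> P))"
    using coeff_ring_adjoin by simp
  then show ?case by (rule exI)
qed

section \<open>Fixed points of finite \<open>p\<close>-groups\<close>

text \<open>Cauchy's theorem, as Sylow's theorem for \<open>q ^ 1\<close>: a prime divisor
  \<open>q\<close> of the order yields a nontrivial element of order dividing both \<open>q\<close>
  and a power of \<open>p\<close>, so \<open>q = p\<close>.\<close>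

lemma (in group) order_eq_prime_power:
  assumes "finite (carrier G)" "prime p" and p: "\<And>x. x \<in> carrier G \<Longrightarrow> \<exists>k. x [^] (p ^ k) = \<one>"
  shows "\<exists>k. Coset.order G = p ^ k"
proof -
  have q: "q = p" if qp: "prime q" "q dvd Coset.order G" for q
  proof (rule ccontr)
    assume "q \<noteq> p"
    obtain m where m: "Coset.order G = q ^ 1 * m" using qp(2) unfolding power_one_right by (rule dvdE)
    obtain H where H: "subgroup H G" "card H = q"
      using sylow_thm[OF qp(1) group_axioms m assms(1)] by auto
    interpret H: subgroup H G by (rule H)
    have "H \<noteq> {\<one>}" using H(2) qp(1) not_prime_1 by auto
    then obtain x where x: "x \<in> H" "x \<noteq> \<one>" using H.one_closed by blast
    then have xG: "x \<in> carrier G" using H.subset by blast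
    obtain k where k: "x [^] (p ^ k) = \<one>" using p[OF xG] by blast
    interpret HG: group "G\<lparr>carrier := H\<rparr>" by (rule subgroup_imp_group[OF H(1)])
    have "x [^]\<^bsub>G\<lparr>carrier := H\<rparr>\<^esub> Coset.order (G\<lparr>carrier := H\<rparr>) = \<one>\<^bsub>G\<lparr>carrier := H\<rparr>\<^esub>"
      using x by (intro HG.pow_order_eq_1) simp
    then have "x [^] q = \<one>" using H(2) by (simp add: Coset.order_def nat_pow_consistent[symmetric])
    then have "ord x dvd q" "ord x dvd p ^ k" using k xG by (simp_all add: pow_eq_id)
    moreover have "coprime q (p ^ k)" using qp(1) assms(2) \<open>q \<noteq> p\<close> primes_coprime by auto
    ultimately have "ord x = 1" by (metis coprime_common_divisor_nat)
    then show False using ord_eq_1[OF xG] x by blast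
  qed
  have "Coset.order G \<noteq> 0" using assms(1) by (simp add: order_gt_0_iff_finite)
  then obtain m where m: "Coset.order G = p ^ multiplicity p (Coset.order G) * m" "\<not> p dvd m"
    using multiplicity_decompose'[of "Coset.order G" p] assms(2) by (metis not_prime_unit)
  have "m = 1"
  proof (rule ccontr)
    assume "m \<noteq> 1"
    then obtain q where "prime q" "q dvd m" using prime_factor_nat by blast
    then show False using q[of q] m by (metis dvd_mult)
  qed
  then show ?thesis using m by auto
qed

text \<open>The moved points are the union of the orbits with more than one element, and the size of
  such an orbit is a power of \<open>p\<close> larger than 1.\<close>

lemma (in group_action) prime_dvd_card_moved:
  assumes "finite E" "prime p" "Coset.order G = p ^ k"
  shows "p dvd card {x \<in> E. \<exists>g\<in>carrier G. \<phi> g x \<noteq> x}"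
proof -
  define M where "M = {x \<in> E. \<exists>g\<in>carrier G. \<phi> g x \<noteq> x}"
  interpret group G using group_hom group_hom.axioms(1) by auto
  have orbE: "orbit G \<phi> x \<subseteq> E" if "x \<in> E" for x
    using element_image that unfolding orbit_def by blast
  have orb_eq: "orbit G \<phi> x = orbit G \<phi> y" if "x \<in> E" "y \<in> orbit G \<phi> x" for x y
  proof -
    have "y \<in> E" using that orbE by blast
    moreover have "x \<in> orbit G \<phi> y" by (rule orbit_sym[OF that(1) \<open>y \<in> E\<close> that(2)])
    ultimately show ?thesis
      using that orbE orbit_trans[of x y] orbit_trans[of y x] by (intro subset_antisym subsetI) blast+
  qed
  have eqM: "M = \<Union> (orbit G \<phi> ` M)"
  proof
    show "M \<subseteq> \<Union> (orbit G \<phi> ` M)" using orbit_refl unfolding M_def by blast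
    show "\<Union> (orbit G \<phi> ` M) \<subseteq> M"
    proof (clarify)
      fix x y assume x: "x \<in> M" and y: "y \<in> orbit G \<phi> x"
      have xE: "x \<in> E" using x M_def by blast
      show "y \<in> M"
      proof (rule ccontr)
        assume "y \<notin> M"
        then have "\<phi> g y = y" if "g \<in> carrier G" for g
          using that y orbE[OF xE] unfolding M_def by blast
        then have "z = y" if "z \<in> orbit G \<phi> y" for z using that unfolding orbit_def by blast
        then have "orbit G \<phi> y = {y}" using orbit_refl y orbE[OF xE] by blast
        then have "orbit G \<phi> x = {y}" using orb_eq[OF xE y] by simp
        then have "z = y" if "z \<in> orbit G \<phi> x" for z using that by simp
        moreover have "\<phi> g x \<in> orbit G \<phi> x" if "g \<in> carrier G" for g
          using that unfolding orbit_def by blast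
        ultimately have "\<phi> g x = x" if "g \<in> carrier G" for g
          using that orbit_refl[OF xE] by metis
        then show False using x unfolding M_def by blast
      qed
    qed
  qed
  have "p dvd card (\<Union> (orbit G \<phi> ` M))"
  proof (intro dvd_partition ballI impI)
    show "finite (\<Union> (orbit G \<phi> ` M))" using eqM assms(1) by (simp add: M_def)
  next
    fix c assume "c \<in> orbit G \<phi> ` M"
    then obtain x where x: "x \<in> M" "c = orbit G \<phi> x" by blast
    then have xE: "x \<in> E" by (simp add: M_def)
    obtain g where g: "g \<in> carrier G" "\<phi> g x \<noteq> x" using x M_def by blast
    have "{x, \<phi> g x} \<subseteq> c" using orbit_refl[OF xE] g x unfolding orbit_def by blast
    moreover have "finite c" using orbE[OF xE] assms(1) x finite_subset by blast
    ultimately have "card {x, \<phi> g x} \<le> card c" by (intro card_mono)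
    then have "card c \<noteq> 1" using g(2) by simp
    moreover have "card c dvd p ^ k"
      using orbit_stabilizer_theorem[OF xE] unfolding x(2) assms(3)[symmetric] by (rule dvdI[OF sym])
    then obtain j where "card c = p ^ j" using divides_primepow_nat[OF assms(2)] by blast
    ultimately show "p dvd card c" by (cases j) auto
  next
    fix c1 c2 assume "c1 \<in> orbit G \<phi> ` M" "c2 \<in> orbit G \<phi> ` M" "c1 \<noteq> c2"
    then obtain x y where x: "x \<in> M" "c1 = orbit G \<phi> x" and y: "y \<in> M" "c2 = orbit G \<phi> y" by blast
    then have E: "x \<in> E" "y \<in> E" by (auto simp: M_def)
    show "c1 \<inter> c2 = {}"
    proof (rule ccontr)
      assume "c1 \<inter> c2 \<noteq> {}"
      then obtain z where z: "z \<in> orbit G \<phi> x" "z \<in> orbit G \<phi> y" using x(2) y(2) by blast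
      have "c1 = c2" unfolding x(2) y(2) using orb_eq[OF E(1) z(1)] orb_eq[OF E(2) z(2)] by (rule trans[OF _ sym])
      then show False using \<open>c1 \<noteq> c2\<close> by contradiction
    qed
  qed
  then show ?thesis using eqM unfolding M_def by simp
qed

text \<open>Only a set of maps closed under composition is given, on a type that may exceed
  \<open>X\<close>. Inverses are supplied by powers, since each map has \<open>p\<close>-power order
  on \<open>X\<close>; restricting the maps to \<open>X\<close> produces a subgroup of the symmetric
  group.\<close>

lemma prime_dvd_card_moved_maps:
  assumes "finite X" "prime p"
    and F: "\<And>f. f \<in> F \<Longrightarrow> f ` X \<subseteq> X" "id \<in> F" "\<And>f g. f \<in> F \<Longrightarrow> g \<in> F \<Longrightarrow> f \<circ> g \<in> F"
    and p: "\<And>f. f \<in> F \<Longrightarrow> \<exists>k. \<forall>x\<in>X. (f ^^ (p ^ k)) x = x"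
  shows "p dvd card {x \<in> X. \<exists>f\<in>F. f x \<noteq> x}"
proof -
  define B where "B = BijGroup X"
  define P where "P = (\<lambda>f. restrict f X) ` F"
  interpret B: group B unfolding B_def by (rule group_BijGroup)
  have funpow_F: "f ^^ n \<in> F" if "f \<in> F" for f n
  proof (induction n)
    case 0
    show ?case using F(2) by (simp add: id_def)
  next
    case (Suc n)
    show ?case using F(3)[OF that Suc] by (simp only: funpow.simps)
  qed
  have inv_F: "\<exists>g\<in>F. \<forall>x\<in>X. g (f x) = x \<and> f (g x) = x" if fF: "f \<in> F" for f
  proof -
    obtain k where k: "\<forall>x\<in>X. (f ^^ (p ^ k)) x = x" using p[OF fF] by blast
    obtain n where n: "p ^ k = Suc n" using assms(2) prime_gt_0_nat not0_implies_Suc[of "p ^ k"] by auto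
    have "(f ^^ n) (f x) = x" "f ((f ^^ n) x) = x" if "x \<in> X" for x
      using k that unfolding n by (auto simp: funpow_swap1)
    then show ?thesis using funpow_F[OF fF] by blast
  qed
  have bij: "restrict f X \<in> Bij X" if f: "f \<in> F" for f
  proof -
    obtain g where g: "g \<in> F" "\<forall>x\<in>X. g (f x) = x \<and> f (g x) = x" using inv_F[OF f] by blast
    have "bij_betw f X X"
      by (rule bij_betw_byWitness[of X g f X]) (use g F(1) f in blast)+
    then show ?thesis unfolding Bij_def by (simp add: bij_betw_restrict_eq)
  qed
  have mult_eq: "restrict f X \<otimes>\<^bsub>B\<^esub> restrict g X = restrict (f \<circ> g) X" if "f \<in> F" "g \<in> F" for f g
    using bij[OF that(1)] bij[OF that(2)] F(1)[OF that(2)]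
    by (auto simp: B_def BijGroup_def compose_def fun_eq_iff)
  have one_eq: "\<one>\<^bsub>B\<^esub> = restrict id X" by (auto simp: B_def BijGroup_def)
  have carr: "restrict f X \<in> carrier B" if "f \<in> F" for f
    using bij[OF that] by (simp add: B_def BijGroup_def)
  have pow_eq: "restrict f X [^]\<^bsub>B\<^esub> n = restrict (f ^^ n) X" if "f \<in> F" for f and n :: nat
  proof (induction n)
    case (Suc n)
    have "restrict f X [^]\<^bsub>B\<^esub> Suc n = restrict (f ^^ n) X \<otimes>\<^bsub>B\<^esub> restrict f X"
      by (simp only: B.nat_pow_Suc Suc)
    also have "\<dots> = restrict (f ^^ n \<circ> f) X" by (rule mult_eq[OF funpow_F[OF that] that])
    also have "f ^^ n \<circ> f = f ^^ Suc n" by (rule funpow_Suc_right[symmetric])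
    finally show ?case .
  qed (simp add: one_eq id_def)
  have sub: "subgroup P B"
  proof (rule B.subgroupI)
    show "P \<subseteq> carrier B" unfolding P_def using carr by blast
    show "P \<noteq> {}" unfolding P_def using F(2) by blast
  next
    fix a assume "a \<in> P"
    then obtain f where f: "f \<in> F" "a = restrict f X" unfolding P_def by blast
    obtain g where g: "g \<in> F" "\<forall>x\<in>X. g (f x) = x \<and> f (g x) = x" using inv_F[OF f(1)] by blast
    have "restrict g X \<otimes>\<^bsub>B\<^esub> a = restrict (g \<circ> f) X" 
      unfolding f(2) by (rule mult_eq[OF g(1) f(1)])
    also have "\<dots> = \<one>\<^bsub>B\<^esub>" unfolding one_eq by (rule restrict_ext) (simp add: g(2))
    finally have "inv\<^bsub>B\<^esub> a = restrict g X"
      by (rule B.inv_equality) (simp_all only: f(2) carr[OF f(1)] carr[OF g(1)])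
    then show "inv\<^bsub>B\<^esub> a \<in> P" unfolding P_def using g by blast
  next
    fix a b assume "a \<in> P" "b \<in> P"
    then obtain f g where "f \<in> F" "a = restrict f X" "g \<in> F" "b = restrict g X" unfolding P_def by blast
    then show "a \<otimes>\<^bsub>B\<^esub> b \<in> P"
      unfolding P_def by (simp only: mult_eq) (intro imageI F(3))
  qed
  define G where "G = B\<lparr>carrier := P\<rparr>"
  interpret G: group G unfolding G_def by (rule B.subgroup_imp_group[OF sub])
  interpret group_action G X id
    using B.canonical_inj_is_hom[OF sub] unfolding group_action_def G_def B_def .
  have "P \<subseteq> X \<rightarrow>\<^sub>E X"
  proof
    fix h assume "h \<in> P"
    then obtain f where f: "f \<in> F" "h = restrict f X" unfolding P_def by blast
    then have "f x \<in> X" if "x \<in> X" for x using F(1)[OF f(1)] that by blast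
    then show "h \<in> X \<rightarrow>\<^sub>E X" unfolding f(2) by (intro PiE_I) simp_all
  qed
  then have "finite P" by (rule finite_subset) (simp add: finite_PiE assms(1))
  moreover have "\<exists>k. x [^]\<^bsub>G\<^esub> (p ^ k) = \<one>\<^bsub>G\<^esub>" if xG: "x \<in> carrier G" for x
  proof -
    obtain f where f: "f \<in> F" "x = restrict f X" using xG unfolding G_def P_def by auto
    obtain k where k: "\<forall>x\<in>X. (f ^^ (p ^ k)) x = x" using p[OF f(1)] by blast
    have "x [^]\<^bsub>G\<^esub> (p ^ k) = restrict f X [^]\<^bsub>B\<^esub> (p ^ k)"
      using f B.nat_pow_consistent[of x "p ^ k" P] by (simp add: G_def)
    also have "\<dots> = restrict (f ^^ (p ^ k)) X" by (rule pow_eq[OF f(1)])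
    also have "\<dots> = \<one>\<^bsub>B\<^esub>" unfolding one_eq by (rule restrict_ext) (simp add: k)
    also have "\<dots> = \<one>\<^bsub>G\<^esub>" by (simp add: G_def)
    finally show ?thesis by blast
  qed
  ultimately obtain k where "Coset.order G = p ^ k"
    using G.order_eq_prime_power[of p] assms(2) unfolding G_def by auto
  from prime_dvd_card_moved[OF assms(1,2) this]
  have "p dvd card {x \<in> X. \<exists>g\<in>P. g x \<noteq> x}" by (simp add: G_def)
  also have "{x \<in> X. \<exists>g\<in>P. g x \<noteq> x} = {x \<in> X. \<exists>f\<in>F. f x \<noteq> x}" unfolding P_def by auto
  finally show ?thesis .
qed

text \<open>\<open>F\<close> acts as a \<open>p\<close>-group on the nonzero finite group
  \<open>L / U\<close> of exponent \<open>p\<close>; \<open>((+) v ^^ p) 0\<close> is the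
  \<open>p\<close>-fold sum of \<open>v\<close>. The number of fixed cosets is divisible by
  \<open>p\<close> and positive, because the zero coset is fixed, so there is another one.\<close>

lemma ex_fixed_coset:
  fixes L U :: "'v::ab_group_add set"
  assumes L: "0 \<in> L" "\<And>x y. x \<in> L \<Longrightarrow> y \<in> L \<Longrightarrow> x - y \<in> L"
    and U: "U \<subseteq> L" "U \<noteq> L" "0 \<in> U" "\<And>x y. x \<in> U \<Longrightarrow> y \<in> U \<Longrightarrow> x - y \<in> U"
    and fin: "finite T" "\<And>x. x \<in> L \<Longrightarrow> \<exists>y\<in>T. y \<in> L \<and> x - y \<in> U"
    and p: "prime p" "\<And>v. v \<in> L \<Longrightarrow> ((+) v ^^ p) 0 \<in> U"
    and F: "id \<in> F" "\<And>f g. f \<in> F \<Longrightarrow> g \<in> F \<Longrightarrow> f \<circ> g \<in> F" "\<And>f. f \<in> F \<Longrightarrow> f ` L \<subseteq> L"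
      "\<And>f. f \<in> F \<Longrightarrow> f ` U \<subseteq> U" "\<And>f x y. f \<in> F \<Longrightarrow> x \<in> L \<Longrightarrow> y \<in> L \<Longrightarrow> f (x - y) = f x - f y"
      "\<And>f. f \<in> F \<Longrightarrow> \<exists>k. \<forall>x\<in>L. (f ^^ (p ^ k)) x = x"
  shows "\<exists>v\<in>L. v \<notin> U \<and> (\<forall>f\<in>F. f v - v \<in> U)"
proof -
  have Uadd: "x + y \<in> U" if "x \<in> U" "y \<in> U" for x y
    using U(4)[OF that(1) U(4)[OF U(3) that(2)]] by simp
  have Ladd: "x + y \<in> L" if "x \<in> L" "y \<in> L" for x y
    using L(2)[OF that(1) L(2)[OF L(1) that(2)]] by simp
  have sym: "y - x \<in> U" if "x - y \<in> U" for x y using U(4)[OF U(3) that] by simp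
  have trans: "x - z \<in> U" if "x - y \<in> U" "y - z \<in> U" for x y z using Uadd[OF that] by simp
  define r where "r = (\<lambda>x. SOME y. y \<in> L \<and> x - y \<in> U)"
  have r: "r x \<in> L \<and> x - r x \<in> U" if "x \<in> L" for x
    unfolding r_def by (rule someI[of _ x]) (simp add: that U(3))
  have r_eq: "r x = r y" if "x - y \<in> U" for x y
  proof -
    have "x - z \<in> U \<longleftrightarrow> y - z \<in> U" for z using trans[OF that] trans[OF sym[OF that]] by blast
    then show ?thesis unfolding r_def by simp
  qed
  have r_iff: "r x = r y \<longleftrightarrow> x - y \<in> U" if "x \<in> L" "y \<in> L" for x y
  proof
    assume "r x = r y"
    then have "x - r x \<in> U" "r x - y \<in> U" using r[OF that(1)] r[OF that(2)] sym by auto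
    then show "x - y \<in> U" by (rule trans)
  qed (rule r_eq)
  \<comment> \<open>A transversal standing for \<open>L / U\<close>; the representative of the zero
    coset is \<open>r 0\<close>, which need not be 0.\<close>
  define R where "R = r ` L"
  have RL: "x \<in> L" and rR: "r x = x" if xR: "x \<in> R" for x
  proof -
    obtain z where z: "z \<in> L" "x = r z" using xR unfolding R_def by blast
    show "x \<in> L" using r z by blast
    have "z - x \<in> U" using r z by blast
    then show "r x = x" using r_eq[of z x] z by simp
  qed
  have "R \<subseteq> r ` T"
  proof
    fix z assume "z \<in> R"
    then obtain x where x: "x \<in> L" "z = r x" unfolding R_def by blast
    then obtain y where "y \<in> T" "x - y \<in> U" using fin(2) by blast
    then show "z \<in> r ` T" using r_eq[of x y] x by simp
  qed
  then have finR: "finite R" using fin(1) finite_surj by blast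
  have r0: "r 0 \<in> R" "r 0 \<in> U"
  proof -
    show "r 0 \<in> R" unfolding R_def using L(1) by blast
    have "0 - r 0 \<in> U" using r[OF L(1)] by blast
    then show "r 0 \<in> U" using sym[of 0 "r 0"] by simp
  qed
  obtain u where u: "u \<in> L" "u \<notin> U" using U by blast
  \<comment> \<open>Translation by an element outside \<open>U\<close> moves every coset, so the
    count of moved points shows that \<open>p\<close> divides the number of cosets. Agreement is
    asked on \<open>R\<close> only, so that \<open>id\<close> belongs to the set.\<close>
  have "p dvd card {x \<in> R. \<exists>h\<in>{h. \<exists>u\<in>L. \<forall>x\<in>R. h x = r (u + x)}. h x \<noteq> x}"
  proof (rule prime_dvd_card_moved_maps[OF finR p(1)])
    fix h assume "h \<in> {h. \<exists>u\<in>L. \<forall>x\<in>R. h x = r (u + x)}"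
    then obtain u where u: "u \<in> L" "\<forall>x\<in>R. h x = r (u + x)" by blast
    then show hR: "h ` R \<subseteq> R" using RL Ladd by (auto simp: R_def)
    have pow: "(h ^^ n) x = r (((+) u ^^ n) 0 + x)" if "x \<in> R" for n x
    proof (induction n)
      case 0
      show ?case using rR[OF that] by simp
    next
      case (Suc n)
      have uL: "((+) u ^^ n) 0 \<in> L" by (induction n) (auto simp: L(1) u(1) Ladd)
      define y where "y = ((+) u ^^ n) 0 + x"
      have yL: "y \<in> L" unfolding y_def using uL RL[OF that] by (rule Ladd)
      have "(h ^^ Suc n) x = h (r y)" using Suc by (simp add: y_def)
      also have "\<dots> = r (u + r y)" using u yL R_def by blast
      also have "\<dots> = r (u + y)" by (rule r_eq) (use sym[of y "r y"] r[OF yL] in simp)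
      also have "u + y = ((+) u ^^ Suc n) 0 + x" by (simp add: y_def add.assoc)
      finally show ?case .
    qed
    have "(h ^^ (p ^ 1)) x = x" if "x \<in> R" for x
    proof -
      have "(h ^^ p) x = r (((+) u ^^ p) 0 + x)" by (rule pow[OF that])
      also have "\<dots> = r x" by (rule r_eq) (simp add: p(2)[OF u(1)])
      finally show ?thesis using rR[OF that] by simp
    qed
    then show "\<exists>k. \<forall>x\<in>R. (h ^^ (p ^ k)) x = x" by blast
  next
    show "id \<in> {h. \<exists>u\<in>L. \<forall>x\<in>R. h x = r (u + x)}" using rR L(1) by (auto intro!: bexI[of _ 0])
  next
    fix h h' assume "h \<in> {h. \<exists>u\<in>L. \<forall>x\<in>R. h x = r (u + x)}" "h' \<in> {h. \<exists>u\<in>L. \<forall>x\<in>R. h x = r (u + x)}"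
    then obtain u u' where u: "u \<in> L" "\<forall>x\<in>R. h x = r (u + x)" and u': "u' \<in> L" "\<forall>x\<in>R. h' x = r (u' + x)" by blast
    have "(h \<circ> h') x = r ((u + u') + x)" if "x \<in> R" for x
    proof -
      have L': "u' + x \<in> L" using u'(1) RL[OF that] by (rule Ladd)
      have "r (u' + x) \<in> R" using L' unfolding R_def by blast
      then have "(h \<circ> h') x = r (u + r (u' + x))" using u(2) u'(2) that by simp
      also have "\<dots> = r (u + (u' + x))" by (rule r_eq) (use sym[of "u' + x" "r (u' + x)"] r[OF L'] in simp)
      finally show ?thesis by (simp add: add.assoc)
    qed
    then show "h \<circ> h' \<in> {h. \<exists>u\<in>L. \<forall>x\<in>R. h x = r (u + x)}" using Ladd[OF u(1) u'(1)] by blast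
  qed
  also have "{x \<in> R. \<exists>h\<in>{h. \<exists>u\<in>L. \<forall>x\<in>R. h x = r (u + x)}. h x \<noteq> x} = R"
  proof -
    have "r (u + x) \<noteq> x" if "x \<in> R" for x
    proof
      assume "r (u + x) = x"
      then have "r (u + x) = r x" using rR[OF that] by simp
      then have "(u + x) - x \<in> U" using r_iff[OF Ladd[OF u(1) RL[OF that]] RL[OF that]] by blast
      then show False using u(2) by simp
    qed
    moreover have "(\<lambda>x. r (u + x)) \<in> {h. \<exists>u\<in>L. \<forall>x\<in>R. h x = r (u + x)}" using u(1) by blast
    ultimately have "\<exists>h\<in>{h. \<exists>u\<in>L. \<forall>x\<in>R. h x = r (u + x)}. h x \<noteq> x" if "x \<in> R" for x
      using that by (intro bexI[of _ "\<lambda>x. r (u + x)"])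
    then show ?thesis by auto
  qed
  finally have dvdR: "p dvd card R" .
  define M where "M = {x \<in> R. \<exists>h\<in>{h. \<exists>f\<in>F. \<forall>x\<in>R. h x = r (f x)}. h x \<noteq> x}"
  have fcong: "r (f (r x)) = r (f x)" if "f \<in> F" "x \<in> L" for f x
  proof (rule r_eq)
    have "r x - x \<in> U" using r[OF that(2)] sym by blast
    then have "f (r x - x) \<in> U" using F(4)[OF that(1)] by blast
    then show "f (r x) - f x \<in> U" using F(5)[OF that(1)] r that(2) by simp
  qed
  have dvdM: "p dvd card M"
    unfolding M_def
  proof (rule prime_dvd_card_moved_maps[OF finR p(1)])
    fix h assume "h \<in> {h. \<exists>f\<in>F. \<forall>x\<in>R. h x = r (f x)}"
    then obtain f where f: "f \<in> F" "\<forall>x\<in>R. h x = r (f x)" by blast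
    have fL: "f x \<in> L" if "x \<in> L" for x using F(3) f(1) that by blast
    show "h ` R \<subseteq> R" using f(2) fL RL by (auto simp: R_def)
    have pow: "(h ^^ n) x = r ((f ^^ n) x)" if "x \<in> R" for n x
    proof (induction n)
      case 0
      show ?case using rR[OF that] by simp
    next
      case (Suc n)
      have L': "(f ^^ n) x \<in> L" by (induction n) (auto simp: fL RL[OF that])
      have "r ((f ^^ n) x) \<in> R" using L' unfolding R_def by blast
      then show ?case using Suc f(2) fcong[OF f(1) L'] by simp
    qed
    obtain k where "\<forall>x\<in>L. (f ^^ (p ^ k)) x = x" using F(6)[OF f(1)] by blast
    then have "\<forall>x\<in>R. (h ^^ (p ^ k)) x = x" using pow rR RL by simp
    then show "\<exists>k. \<forall>x\<in>R. (h ^^ (p ^ k)) x = x" by blast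
  next
    show "id \<in> {h. \<exists>f\<in>F. \<forall>x\<in>R. h x = r (f x)}" using rR F(1) by (auto intro!: bexI[of _ id])
  next
    fix h h' assume "h \<in> {h. \<exists>f\<in>F. \<forall>x\<in>R. h x = r (f x)}" "h' \<in> {h. \<exists>f\<in>F. \<forall>x\<in>R. h x = r (f x)}"
    then obtain f f' where f: "f \<in> F" "\<forall>x\<in>R. h x = r (f x)" and f': "f' \<in> F" "\<forall>x\<in>R. h' x = r (f' x)" by blast
    have "(h \<circ> h') x = r ((f \<circ> f') x)" if "x \<in> R" for x
    proof -
      have L': "f' x \<in> L" using F(3)[OF f'(1)] RL[OF that] by blast
      have "r (f' x) \<in> R" using L' unfolding R_def by blast
      then show ?thesis using f(2) f'(2) that fcong[OF f(1) L'] by simp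
    qed
    then show "h \<circ> h' \<in> {h. \<exists>f\<in>F. \<forall>x\<in>R. h x = r (f x)}" using F(2)[OF f(1) f'(1)] by blast
  qed
  have "M \<subseteq> R" unfolding M_def by blast
  then have "card (R - M) = card R - card M" using finR by (simp add: card_Diff_subset finite_subset)
  then have dvd: "p dvd card (R - M)" using dvdR dvdM by simp
  have fixed: "r (f x) = x" if "x \<in> R" "x \<notin> M" "f \<in> F" for f x
  proof (rule ccontr)
    assume "r (f x) \<noteq> x"
    moreover have "(\<lambda>x. r (f x)) \<in> {h. \<exists>f\<in>F. \<forall>x\<in>R. h x = r (f x)}" using that(3) by blast
    ultimately have "\<exists>h\<in>{h. \<exists>f\<in>F. \<forall>x\<in>R. h x = r (f x)}. h x \<noteq> x"
      by (intro bexI[of _ "\<lambda>x. r (f x)"])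
    then show False using that(1,2) unfolding M_def by simp
  qed
  have "r 0 \<notin> M"
  proof
    assume "r 0 \<in> M"
    then obtain h f where f: "f \<in> F" "\<forall>x\<in>R. h x = r (f x)" and h: "h (r 0) \<noteq> r 0" unfolding M_def by blast
    have "f (r 0) \<in> U" using F(4)[OF f(1)] r0 by blast
    then have "r (f (r 0)) = r 0" using r_eq[of "f (r 0)" 0] by simp
    then show False using f h r0 by simp
  qed
  then have "r 0 \<in> R - M" using r0 by blast
  moreover have "R - M \<noteq> {r 0}"
  proof
    assume "R - M = {r 0}"
    then have "p dvd 1" using dvd by simp
    then show False using p(1) by (simp add: prime_nat_iff)
  qed
  ultimately obtain v where v: "v \<in> R" "v \<notin> M" "v \<noteq> r 0" by blast
  have "v \<notin> U"
  proof
    assume "v \<in> U"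
    then have "r v = r 0" using r_eq[of v 0] by simp
    then show False using v rR by simp
  qed
  moreover have "f v - v \<in> U" if "f \<in> F" for f
  proof -
    have "f v \<in> L" using F(3)[OF that] RL[OF v(1)] by blast
    then have "f v - r (f v) \<in> U" using r by blast
    then show ?thesis using fixed[OF v(1,2) that] by simp
  qed
  ultimately show ?thesis using RL[OF v(1)] by blast
qed

section \<open>Vectors over a coefficient ring and the fixed-point filtration\<close>

text \<open>Functions vanishing from \<open>m\<close> on replace column vectors: they inherit
  addition and subtraction pointwise from the function type, with no dimension to carry
  along.\<close>

definition vecs :: "nat \<Rightarrow> 'a::zero set \<Rightarrow> (nat \<Rightarrow> 'a) set" where
  "vecs m S = {v. (\<forall>i<m. v i \<in> S) \<and> (\<forall>i. \<not> i < m \<longrightarrow> v i = 0)}"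

lemma vecsI: "(\<And>i. i < m \<Longrightarrow> v i \<in> S) \<Longrightarrow> (\<And>i. \<not> i < m \<Longrightarrow> v i = 0) \<Longrightarrow> v \<in> vecs m S"
  unfolding vecs_def by simp

lemma vecsD: "v \<in> vecs m S \<Longrightarrow> i < m \<Longrightarrow> v i \<in> S" "v \<in> vecs m S \<Longrightarrow> \<not> i < m \<Longrightarrow> v i = 0"
  unfolding vecs_def by (auto split: if_splits)

lemma finite_card_vecs:
  assumes "finite S"
  shows "finite (vecs m S)" "card (vecs m S) \<le> card S ^ m"
proof -
  let ?P = "{..<m} \<rightarrow>\<^sub>E S"
  have fin: "finite ?P" using assms by (simp add: finite_PiE)
  have sub: "vecs m S \<subseteq> (\<lambda>f i. if i < m then f i else 0) ` ?P"
  proof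
    fix v assume v: "v \<in> vecs m S"
    have "v = (\<lambda>i. if i < m then (restrict v {..<m}) i else 0)" using vecsD[OF v] by auto
    moreover have "restrict v {..<m} \<in> ?P" using vecsD[OF v] by (intro PiE_I) auto
    ultimately show "v \<in> (\<lambda>f i. if i < m then f i else 0) ` ?P" by (rule image_eqI)
  qed
  show "finite (vecs m S)" by (rule finite_subset[OF sub finite_imageI[OF fin]])
  have "card (vecs m S) \<le> card ?P" by (rule surj_card_le[OF fin sub])
  also have "card ?P = card S ^ m" by (simp add: card_PiE)
  finally show "card (vecs m S) \<le> card S ^ m" .
qed

lemma (in coeff_ideal) vecs_closed:
  "0 \<in> vecs m I" "v \<in> vecs m I \<Longrightarrow> w \<in> vecs m I \<Longrightarrow> v - w \<in> vecs m I"
  "v \<in> vecs m I \<Longrightarrow> w \<in> vecs m I \<Longrightarrow> v + w \<in> vecs m I"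
  "a \<in> A \<Longrightarrow> v \<in> vecs m I \<Longrightarrow> (\<lambda>i. a * v i) \<in> vecs m I"
  "a \<in> I \<Longrightarrow> v \<in> vecs m A \<Longrightarrow> (\<lambda>i. a * v i) \<in> vecs m I"
  unfolding vecs_def by (simp_all add: ideal_zero ideal_diff ideal_add absorb absorb')

text \<open>The invariant filtration \<open>U 0 \<subseteq> U 1 \<subseteq> \<dots>\<close> with \<open>U 0 = P\<^sup>m\<close>, in which \<open>U (i + 1)\<close> is the
  preimage of the fixed points modulo \<open>U i\<close>, grows by a factor of at least \<open>\<bar>A/P\<bar>\<close> in each step.\<close>

lemma (in finite_prime) fixed_point_filtration:
  assumes p: "prime p" "of_nat p \<in> P"
    and F: "id \<in> F" "\<And>f g. f \<in> F \<Longrightarrow> g \<in> F \<Longrightarrow> f \<circ> g \<in> F"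
      "\<And>f. f \<in> F \<Longrightarrow> f ` vecs m A \<subseteq> vecs m A" "\<And>f. f \<in> F \<Longrightarrow> f ` vecs m P \<subseteq> vecs m P"
      "\<And>f v w. f \<in> F \<Longrightarrow> v \<in> vecs m A \<Longrightarrow> w \<in> vecs m A \<Longrightarrow> f (v - w) = f v - f w"
      "\<And>f v a. f \<in> F \<Longrightarrow> v \<in> vecs m A \<Longrightarrow> a \<in> A \<Longrightarrow> f (\<lambda>i. a * v i) = (\<lambda>i. a * f v i)"
      "\<And>f. f \<in> F \<Longrightarrow> \<exists>k. \<forall>v\<in>vecs m A. (f ^^ (p ^ k)) v = v"
    and U: "U 0 = vecs m P" "\<And>i. U (Suc i) = {v \<in> vecs m A. \<forall>f\<in>F. f v - v \<in> U i}"
  shows "U m = vecs m A"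
proof -
  have PA: "vecs m P \<subseteq> vecs m A" using subset unfolding vecs_def by auto
  \<comment> \<open>Each \<open>U i\<close> is an \<open>F\<close>-invariant
    \<open>A\<close>-submodule between \<open>vecs m P\<close> and \<open>vecs m A\<close>; all
    these facts are carried through one induction.\<close>
  have sub: "vecs m P \<subseteq> U i \<and> U i \<subseteq> vecs m A \<and> (\<forall>v\<in>U i. \<forall>w\<in>U i. v - w \<in> U i) \<and>
      (\<forall>a\<in>A. \<forall>v\<in>U i. (\<lambda>j. a * v j) \<in> U i) \<and> (\<forall>f\<in>F. f ` U i \<subseteq> U i)" for i
  proof (induction i)
    case 0
    show ?case unfolding U(1) by (intro conjI ballI subset_refl PA vecs_closed(2,4) F(4))
  next
    case (Suc i)
    have PU: "vecs m P \<subseteq> U i" and UA: "U i \<subseteq> vecs m A"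
      and Udiff: "\<And>v w. v \<in> U i \<Longrightarrow> w \<in> U i \<Longrightarrow> v - w \<in> U i"
      and Uscale: "\<And>a v. a \<in> A \<Longrightarrow> v \<in> U i \<Longrightarrow> (\<lambda>j. a * v j) \<in> U i"
      using Suc by blast+
    have P': "vecs m P \<subseteq> U (Suc i)"
    proof
      fix v assume v: "v \<in> vecs m P"
      have "f v - v \<in> U i" if "f \<in> F" for f
        using F(4)[OF that] v vecs_closed(2) PU by blast
      then show "v \<in> U (Suc i)" unfolding U(2) using v PA by blast
    qed
    have A': "U (Suc i) \<subseteq> vecs m A" unfolding U(2) by blast
    have diff': "v - w \<in> U (Suc i)" if vw: "v \<in> U (Suc i)" "w \<in> U (Suc i)" for v w
    proof -
      have L: "v \<in> vecs m A" "w \<in> vecs m A" using vw A' by auto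
      have "f (v - w) - (v - w) \<in> U i" if "f \<in> F" for f
      proof -
        have "f (v - w) - (v - w) = (f v - v) - (f w - w)" using F(5)[OF that L] by simp
        moreover have "f v - v \<in> U i" "f w - w \<in> U i" using vw that unfolding U(2) by auto
        ultimately show ?thesis using Udiff by metis
      qed
      then show ?thesis unfolding U(2) using self.vecs_closed(2)[OF L] by blast
    qed
    have scale': "(\<lambda>j. a * v j) \<in> U (Suc i)" if av: "a \<in> A" "v \<in> U (Suc i)" for a v
    proof -
      have L: "v \<in> vecs m A" using av A' by auto
      have "f (\<lambda>j. a * v j) - (\<lambda>j. a * v j) \<in> U i" if "f \<in> F" for f
      proof -
        have "f (\<lambda>j. a * v j) - (\<lambda>j. a * v j) = (\<lambda>j. a * (f v - v) j)"
          using F(6)[OF that L av(1)] by (auto simp: fun_eq_iff algebra_simps)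
        moreover have "f v - v \<in> U i" using av that unfolding U(2) by auto
        ultimately show ?thesis using Uscale[OF av(1)] by metis
      qed
      then show ?thesis unfolding U(2) using self.vecs_closed(4)[OF av(1) L] by blast
    qed
    have inv': "f v \<in> U (Suc i)" if fv: "f \<in> F" "v \<in> U (Suc i)" for f v
    proof -
      have "g (f v) - f v \<in> U i" if "g \<in> F" for g
      proof -
        have "(g \<circ> f) v - v \<in> U i" "f v - v \<in> U i" using fv(2) F(2)[OF that fv(1)] fv(1) unfolding U(2) by blast+
        from Udiff[OF this] show ?thesis by simp
      qed
      moreover have "f v \<in> vecs m A" using F(3)[OF fv(1)] A' fv(2) by blast
      ultimately show ?thesis unfolding U(2) by blast
    qed
    show ?case using P' A' diff' scale' inv' by blast
  qed
  then have PU: "vecs m P \<subseteq> U i" and UA: "U i \<subseteq> vecs m A"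
    and Udiff: "v \<in> U i \<Longrightarrow> w \<in> U i \<Longrightarrow> v - w \<in> U i"
    and Uscale: "a \<in> A \<Longrightarrow> v \<in> U i \<Longrightarrow> (\<lambda>j. a * v j) \<in> U i"
    and Uinv: "f \<in> F \<Longrightarrow> f ` U i \<subseteq> U i" for i v w a f
    by blast+
  have U0: "0 \<in> U i" for i using PU vecs_closed(1) by blast
  have Uadd: "v + w \<in> U i" if "v \<in> U i" "w \<in> U i" for v w i
    using Udiff[OF that(1) Udiff[OF U0 that(2)]] by simp
  have mono: "U i \<subseteq> U (Suc i)" for i
    unfolding U(2)[of i] using UA[of i] Uinv[of _ i] Udiff[of _ i] by blast
  \<comment> \<open>Representatives of \<open>vecs m A\<close> modulo \<open>vecs m P\<close>;
    counting those in \<open>U i\<close> measures \<open>U i\<close> over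
    \<open>vecs m P\<close>.\<close>
  define T where "T = vecs m (rep ` A)"
  have finT: "finite T" and cardT: "card T \<le> card (rep ` A) ^ m"
    using finite_card_vecs[of "rep ` A" m] finite_index unfolding T_def finite_index_def by auto
  have TA: "T \<subseteq> vecs m A" unfolding T_def vecs_def using rep_closed by auto
  define R where "R v = (\<lambda>i. if i < m then rep (v i) else 0)" for v
  have R: "R v \<in> T" "v - R v \<in> vecs m P" if "v \<in> vecs m A" for v
    using that rep_cong unfolding T_def R_def by (auto intro!: vecsI dest: vecsD)
  have rep_rep: "rep x = x" if x: "x \<in> rep ` A" for x
  proof -
    obtain y where y: "y \<in> A" "x = rep y" using x by blast
    then have "rep y - y \<in> P" using rep_cong cong_sym by blast
    then show ?thesis using rep_eq_iff[of x y] y rep_closed by simp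
  qed
  have R_T: "R v = v" if "v \<in> T" for v
  proof
    fix i show "R v i = v i"
      using vecsD[OF that[unfolded T_def], of i] rep_rep[of "v i"] by (simp add: R_def)
  qed
  have R_eqI: "v - w \<in> vecs m P" if "R v = R w" "v \<in> vecs m A" "w \<in> vecs m A" for v w
  proof (rule vecsI)
    fix i assume "i < m"
    then have "rep (v i) = rep (w i)" using fun_cong[OF that(1), of i] by (simp add: R_def)
    then show "(v - w) i \<in> P" 
      using rep_eq_iff[OF vecsD(1)[OF that(2) \<open>i < m\<close>] vecsD(1)[OF that(3) \<open>i < m\<close>]] by simp
  next
    fix i assume "\<not> i < m"
    then show "(v - w) i = 0" using vecsD(2)[OF that(2)] vecsD(2)[OF that(3)] by simp
  qed
  have R_eqI': "R v = R w" if "v - w \<in> vecs m P" "v \<in> vecs m A" "w \<in> vecs m A" for v w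
  proof
    fix i show "R v i = R w i"
      using vecsD(1)[OF that(1), of i] vecsD(1)[OF that(2), of i] vecsD(1)[OF that(3), of i]
        rep_eq_iff[of "v i" "w i"] by (simp add: R_def)
  qed
  \<comment> \<open>A vector \<open>v\<close> outside \<open>U i\<close> but fixed modulo
    \<open>U i\<close> contributes a new direction: the classes of \<open>c * v + w\<close>, with
    \<open>c\<close> a residue and \<open>w\<close> in \<open>U i\<close>, are distinct and lie in
    \<open>U (Suc i)\<close>.\<close>
  have step: "card (rep ` A) * card (U i \<inter> T) \<le> card (U (Suc i) \<inter> T)" if ne: "U i \<noteq> vecs m A" for i
  proof -
    have "\<exists>v\<in>vecs m A. v \<notin> U i \<and> (\<forall>f\<in>F. f v - v \<in> U i)"
    proof (rule ex_fixed_coset)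
      show "0 \<in> vecs m A" "\<And>x y. x \<in> vecs m A \<Longrightarrow> y \<in> vecs m A \<Longrightarrow> x - y \<in> vecs m A"
        by (rule self.vecs_closed)+
      show "U i \<subseteq> vecs m A" "U i \<noteq> vecs m A" "0 \<in> U i" by (rule UA ne U0)+
      show "\<And>x y. x \<in> U i \<Longrightarrow> y \<in> U i \<Longrightarrow> x - y \<in> U i" by (rule Udiff)
      show "finite T" by (rule finT)
      show "\<And>x. x \<in> vecs m A \<Longrightarrow> \<exists>y\<in>T. y \<in> vecs m A \<and> x - y \<in> U i" using R PU TA by blast
      show "prime p" by (rule p)
      show "((+) v ^^ p) 0 \<in> U i" if v: "v \<in> vecs m A" for v
      proof -
        have "((+) v ^^ n) 0 = (\<lambda>i. of_nat n * v i)" for n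
          by (induction n) (auto simp: fun_eq_iff algebra_simps)
        then have "((+) v ^^ p) 0 \<in> vecs m P" using vecs_closed(5)[OF p(2) v] by simp
        then show ?thesis using PU by blast
      qed
      show "id \<in> F" "\<And>f g. f \<in> F \<Longrightarrow> g \<in> F \<Longrightarrow> f \<circ> g \<in> F" by (rule F)+
      show "f ` vecs m A \<subseteq> vecs m A" "f ` U i \<subseteq> U i" "\<exists>k. \<forall>x\<in>vecs m A. (f ^^ (p ^ k)) x = x"
        if "f \<in> F" for f by (rule F Uinv that)+
      show "\<And>f x y. f \<in> F \<Longrightarrow> x \<in> vecs m A \<Longrightarrow> y \<in> vecs m A \<Longrightarrow> f (x - y) = f x - f y" by (rule F)
    qed
    then obtain v where v: "v \<in> vecs m A" "v \<notin> U i" "v \<in> U (Suc i)" unfolding U(2) by blast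
    define \<phi> where "\<phi> = (\<lambda>(c, w). R ((\<lambda>j. c * v j) + w))"
    have closed: "(\<lambda>j. c * v j) + w \<in> vecs m A \<and> (\<lambda>j. c * v j) + w \<in> U (Suc i)"
      if "c \<in> A" "w \<in> U i" for c w
    proof -
      have "(\<lambda>j. c * v j) + w \<in> U (Suc i)" using Uadd[OF Uscale[OF that(1) v(3)]] mono that(2) by blast
      then show ?thesis using UA by blast
    qed
    have "inj_on \<phi> (rep ` A \<times> (U i \<inter> T))"
    proof (rule inj_onI)
      fix x y assume x: "x \<in> rep ` A \<times> (U i \<inter> T)" and y: "y \<in> rep ` A \<times> (U i \<inter> T)"
        and eq: "\<phi> x = \<phi> y"
      obtain c w d w' where xy: "x = (c, w)" "y = (d, w')" by (cases x, cases y)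
      have w: "w \<in> U i" "w \<in> T" and w': "w' \<in> U i" "w' \<in> T"
        and c: "c \<in> rep ` A" and d: "d \<in> rep ` A" using x y unfolding xy by simp_all
      have cd: "c \<in> A" "d \<in> A" "rep c = c" "rep d = d"
        using c d rep_closed rep_rep[OF c] rep_rep[OF d] by auto
      have "R ((\<lambda>j. c * v j) + w) = R ((\<lambda>j. d * v j) + w')"
        using eq unfolding \<phi>_def xy prod.case .
      then have "((\<lambda>j. c * v j) + w) - ((\<lambda>j. d * v j) + w') \<in> vecs m P"
        using closed[OF cd(1) w(1)] closed[OF cd(2) w'(1)] by (elim R_eqI conjE) blast+
      moreover have "((\<lambda>j. c * v j) + w) - ((\<lambda>j. d * v j) + w') = (\<lambda>j. (c - d) * v j) + (w - w')"
        by (auto simp: fun_eq_iff algebra_simps)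
      ultimately have dP: "(\<lambda>j. (c - d) * v j) + (w - w') \<in> vecs m P" by (simp only:)
      then have "((\<lambda>j. (c - d) * v j) + (w - w')) - (w - w') \<in> U i"
        by (intro Udiff[OF subsetD[OF PU]] Udiff w(1) w'(1))
      then have dU: "(\<lambda>j. (c - d) * v j) \<in> U i" by (simp only: add_diff_cancel_right')
      \<comment> \<open>Otherwise \<open>c - d\<close> is a unit modulo \<open>P\<close>, and
        dividing by it would put \<open>v\<close> into \<open>U i\<close>.\<close>
      have "c = d"
      proof (rule ccontr)
        assume "c \<noteq> d"
        then have "c - d \<notin> P" using rep_eq_iff[OF cd(1,2)] cd(3,4) by simp
        then obtain e where e: "e \<in> A" "e * (c - d) - 1 \<in> P" using inverse_mod[OF diff[OF cd(1,2)]] by blast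
        have "(\<lambda>j. e * ((c - d) * v j)) - (\<lambda>j. (e * (c - d) - 1) * v j) \<in> U i"
          by (rule Udiff[OF Uscale[OF e(1) dU]]) (use vecs_closed(5)[OF e(2) v(1)] PU in blast)
        moreover have "(\<lambda>j. e * ((c - d) * v j)) - (\<lambda>j. (e * (c - d) - 1) * v j) = v"
          by (auto simp: fun_eq_iff algebra_simps)
        ultimately show False using v(2) by (simp only:)
      qed
      moreover have "w = w'"
      proof -
        have "(\<lambda>j. (c - d) * v j) + (w - w') = w - w'" using \<open>c = d\<close> by (auto simp: fun_eq_iff)
        then have "w - w' \<in> vecs m P" using dP by (simp only:)
        then have "R w = R w'" using R_eqI' w w' TA by blast
        then show ?thesis using R_T w w' by simp
      qed
      ultimately show "x = y" by (simp add: xy)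
    qed
    moreover have "\<phi> ` (rep ` A \<times> (U i \<inter> T)) \<subseteq> U (Suc i) \<inter> T"
    proof
      fix y assume "y \<in> \<phi> ` (rep ` A \<times> (U i \<inter> T))"
      then obtain a w where y: "y = \<phi> (rep a, w)" and "a \<in> A" "w \<in> U i" "w \<in> T" by auto
      define u where "u = (\<lambda>j. rep a * v j) + w"
      have u: "u \<in> vecs m A" "u \<in> U (Suc i)"
        using closed[OF rep_closed[OF \<open>a \<in> A\<close>] \<open>w \<in> U i\<close>] unfolding u_def by blast+
      have "u - (u - R u) \<in> U (Suc i)" using Udiff[OF u(2)] R(2)[OF u(1)] PU by blast
      moreover have "y = R u" unfolding y \<phi>_def u_def prod.case ..
      ultimately show "y \<in> U (Suc i) \<inter> T" using R(1)[OF u(1)] by simp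
    qed
    ultimately have "card (rep ` A \<times> (U i \<inter> T)) \<le> card (U (Suc i) \<inter> T)"
      using finT by (intro card_inj_on_le) auto
    then show ?thesis by (simp add: card_cartesian_product)
  qed
  have "U i = vecs m A \<or> card (rep ` A) ^ i \<le> card (U i \<inter> T)" for i
  proof (induction i)
    case 0
    have "R 0 \<in> T" "0 - R 0 \<in> U 0" using R[OF self.vecs_closed(1)] U(1) by auto
    then have "R 0 \<in> U 0" using Udiff[OF U0[of 0]] by fastforce
    then have "U 0 \<inter> T \<noteq> {}" using \<open>R 0 \<in> T\<close> by blast
    then have "0 < card (U 0 \<inter> T)" using finT by (simp add: card_gt_0_iff)
    then show ?case by simp
  next
    case (Suc i)
    show ?case
    proof (cases "U i = vecs m A")
      case True
      then show ?thesis using mono[of i] UA[of "Suc i"] by blast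
    next
      case False
      then have "card (rep ` A) ^ i \<le> card (U i \<inter> T)" using Suc by blast
      then have "card (rep ` A) ^ Suc i \<le> card (rep ` A) * card (U i \<inter> T)"
        unfolding power_Suc by (rule mult_le_mono2)
      then show ?thesis using step[OF False] le_trans by blast
    qed
  qed
  \<comment> \<open>At \<open>i = m\<close> the lower bound reaches the number of all classes, so
    \<open>U m\<close> contains every representative.\<close>
  then consider "U m = vecs m A" | "card T \<le> card (U m \<inter> T)" using cardT le_trans by blast
  then show ?thesis
  proof cases
    case 2
    then have "U m \<inter> T = T" using finT by (intro card_seteq) auto
    then have "v \<in> U m" if "v \<in> vecs m A" for v
    proof -
      have "R v \<in> U m" "v - R v \<in> U m" using R[OF that] PU \<open>U m \<inter> T = T\<close> by blast+
      from Uadd[OF this] show ?thesis by simp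
    qed
    then show ?thesis using UA by blast
  qed
qed

section \<open>Congruences of matrices\<close>

lemma index_mult_mat_sum:
  assumes "X \<in> carrier_mat m m" "Y \<in> carrier_mat m m" "i < m" "j < m"
  shows "(X * Y) $$ (i, j) = (\<Sum>k<m. X $$ (i, k) * Y $$ (k, j))"
  using assms by (simp add: scalar_prod_def atLeast0LessThan)

definition mats_over :: "nat \<Rightarrow> 'a set \<Rightarrow> 'a mat set" where
  "mats_over m S = {X \<in> carrier_mat m m. \<forall>i<m. \<forall>j<m. X $$ (i, j) \<in> S}"

lemma mats_overD:
  assumes "X \<in> mats_over m S"
  shows "X \<in> carrier_mat m m" "i < m \<Longrightarrow> j < m \<Longrightarrow> X $$ (i, j) \<in> S"
  using assms unfolding mats_over_def by auto

lemma finite_mats_over: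
  assumes "finite S"
  shows "finite (mats_over m S)"
proof -
  have sub: "mats_over m S \<subseteq> mat m m ` (({..<m} \<times> {..<m}) \<rightarrow>\<^sub>E S)"
  proof
    fix X assume X: "X \<in> mats_over m S"
    define f where "f = (\<lambda>ij\<in>{..<m} \<times> {..<m}. X $$ ij)"
    have "X = mat m m f" using mats_overD[OF X] by (intro eq_matI) (auto simp: f_def)
    moreover have "f \<in> ({..<m} \<times> {..<m}) \<rightarrow>\<^sub>E S" using mats_overD[OF X] by (auto simp: f_def)
    ultimately show "X \<in> mat m m ` (({..<m} \<times> {..<m}) \<rightarrow>\<^sub>E S)" by (rule image_eqI)
  qed
  have "finite (({..<m} \<times> {..<m}) \<rightarrow>\<^sub>E S)" using assms by (simp add: finite_PiE)
  then show ?thesis by (rule finite_subset[OF sub finite_imageI])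
qed

lemma (in coeff_ring) mats_over_closed:
  "1\<^sub>m m \<in> mats_over m A" "0\<^sub>m m m \<in> mats_over m A"
  "X \<in> mats_over m A \<Longrightarrow> Y \<in> mats_over m A \<Longrightarrow> X + Y \<in> mats_over m A"
  "X \<in> mats_over m A \<Longrightarrow> Y \<in> mats_over m A \<Longrightarrow> X - Y \<in> mats_over m A"
  "X \<in> mats_over m A \<Longrightarrow> Y \<in> mats_over m A \<Longrightarrow> X * Y \<in> mats_over m A"
  unfolding mats_over_def
  by (auto simp: one zero add diff index_mult_mat_sum simp del: index_mult_mat(1) intro!: sum mult)

lemma (in coeff_ring) pow_mats_over: "X \<in> mats_over m A \<Longrightarrow> X ^\<^sub>m k \<in> mats_over m A"
proof (induction k)
  case 0
  then show ?case using mats_overD(1)[of X m A] mats_over_closed(1)[of m] by simp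
qed (simp add: mats_over_closed)

definition (in coeff_ideal) mat_cong :: "nat \<Rightarrow> 'a mat \<Rightarrow> 'a mat \<Rightarrow> bool" where
  "mat_cong m X Y \<longleftrightarrow> (\<forall>i<m. \<forall>j<m. X $$ (i, j) - Y $$ (i, j) \<in> I)"

context coeff_ideal
begin

lemma mat_cong_refl: "mat_cong m X X"
  by (simp add: mat_cong_def ideal_zero)

lemma mat_cong_sym: "mat_cong m X Y \<Longrightarrow> mat_cong m Y X"
  by (simp add: mat_cong_def cong_sym)

lemma mat_cong_mult:
  assumes "X \<in> mats_over m A" "X' \<in> mats_over m A" "Y \<in> mats_over m A" "Y' \<in> mats_over m A"
    and "mat_cong m X X'" "mat_cong m Y Y'"
  shows "mat_cong m (X * Y) (X' * Y')"
  unfolding mat_cong_def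
proof (intro allI impI)
  fix i j assume ij: "i < m" "j < m"
  have "(\<Sum>k<m. X $$ (i, k) * Y $$ (k, j)) - (\<Sum>k<m. X' $$ (i, k) * Y' $$ (k, j)) \<in> I"
    using assms ij by (intro cong_sum cong_mult) (auto simp: mat_cong_def dest: mats_overD)
  then show "(X * Y) $$ (i, j) - (X' * Y') $$ (i, j) \<in> I"
    using assms(1-4)[THEN mats_overD(1)] ij by (simp add: index_mult_mat_sum del: index_mult_mat(1))
qed

lemma mat_cong_pow:
  assumes "X \<in> mats_over m A" "mat_cong m X (1\<^sub>m m)"
  shows "mat_cong m (X ^\<^sub>m k) (1\<^sub>m m)"
proof (induction k)
  case 0
  show ?case using mats_overD(1)[OF assms(1)] by (simp add: mat_cong_refl)
next
  case (Suc k)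
  have "mat_cong m (X ^\<^sub>m k * X) (1\<^sub>m m * 1\<^sub>m m)"
    by (intro mat_cong_mult Suc assms pow_mats_over mats_over_closed)
  then show ?case by simp
qed

text \<open>By the Leibniz formula the determinant is an integer polynomial in the entries.\<close>

lemma mat_cong_det:
  assumes "X \<in> mats_over m A" "Y \<in> mats_over m A" "mat_cong m X Y"
  shows "det X - det Y \<in> I"
proof -
  have s: "signof p \<in> A" for p by (simp add: sign_def one uminus)
  show ?thesis
    unfolding det_def'[OF mats_overD(1)[OF assms(1)]] det_def'[OF mats_overD(1)[OF assms(2)]]
  proof (rule cong_sum)
    fix p assume "p \<in> {p. p permutes {0..<m}}"
    then have p: "p i < m" if "i < m" for i using that by (simp add: permutes_in_image)
    have "(\<Prod>i = 0..<m. X $$ (i, p i)) - (\<Prod>i = 0..<m. Y $$ (i, p i)) \<in> I"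
      using assms p mats_overD(2)[OF assms(1)] mats_overD(2)[OF assms(2)]
      by (intro cong_prod) (auto simp: mat_cong_def)
    from absorb[OF s this, of p]
    show "signof p * (\<Prod>i = 0..<m. X $$ (i, p i)) - signof p * (\<Prod>i = 0..<m. Y $$ (i, p i)) \<in> I"
      by (simp add: right_diff_distrib)
  qed
qed

end

primrec geom_mat :: "nat \<Rightarrow> 'a::comm_ring_1 mat \<Rightarrow> nat \<Rightarrow> 'a mat" where
  "geom_mat m X 0 = 0\<^sub>m m m"
| "geom_mat m X (Suc k) = geom_mat m X k + X ^\<^sub>m k"

lemma geom_mat:
  assumes X: "X \<in> carrier_mat m m"
  shows geom_mat_carrier: "geom_mat m X k \<in> carrier_mat m m"
    and geom_mat_telescope: "geom_mat m X k * (X - 1\<^sub>m m) = X ^\<^sub>m k - 1\<^sub>m m"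
proof (induction k)
  case 0
  show "geom_mat m X 0 \<in> carrier_mat m m" "geom_mat m X 0 * (X - 1\<^sub>m m) = X ^\<^sub>m 0 - 1\<^sub>m m"
    using X by (auto intro!: eq_matI)
next
  case (Suc k)
  have P: "X ^\<^sub>m k \<in> carrier_mat m m" using X by simp
  show "geom_mat m X (Suc k) \<in> carrier_mat m m" using Suc(1) P by simp
  have X1: "X - 1\<^sub>m m \<in> carrier_mat m m" by (rule minus_carrier_mat[OF one_carrier_mat])
  have "geom_mat m X (Suc k) * (X - 1\<^sub>m m) = geom_mat m X k * (X - 1\<^sub>m m) + X ^\<^sub>m k * (X - 1\<^sub>m m)"
    using add_mult_distrib_mat[OF Suc(1) P X1] by simp
  also have "X ^\<^sub>m k * (X - 1\<^sub>m m) = X ^\<^sub>m Suc k - X ^\<^sub>m k"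
    using mult_minus_distrib_mat[OF P X one_carrier_mat] unfolding right_mult_one_mat[OF P] by simp
  also have "geom_mat m X k * (X - 1\<^sub>m m) + (X ^\<^sub>m Suc k - X ^\<^sub>m k) = X ^\<^sub>m Suc k - 1\<^sub>m m"
    unfolding Suc(2) using P X by (intro eq_matI) (auto simp del: index_mult_mat(1))
  finally show "geom_mat m X (Suc k) * (X - 1\<^sub>m m) = X ^\<^sub>m Suc k - 1\<^sub>m m" .
qed

text \<open>If \<open>X\<close> is congruent to \<open>1\<close>, then \<open>N = 1 + X + \<dots> + X\<^sup>r\<^sup>-\<^sup>1\<close> is congruent to \<open>r\<close>, so \<open>det N\<close>
  is congruent to \<open>r\<^sup>m\<close> and hence nonzero, while \<open>N (X - 1) = X\<^sup>r - 1 = 0\<close>.\<close>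

lemma (in finite_prime) congruence_kernel_torsion:
  assumes X: "X \<in> mats_over m A" "mat_cong m X (1\<^sub>m m)"
    and r: "X ^\<^sub>m r = 1\<^sub>m m" "of_nat r \<notin> P"
  shows "X = 1\<^sub>m m"
proof -
  note XC = mats_overD(1)[OF X(1)]
  define N where "N = geom_mat m X r"
  have NC: "N \<in> carrier_mat m m" unfolding N_def by (rule geom_mat_carrier[OF XC])
  have geom: "geom_mat m X k \<in> mats_over m A \<and> mat_cong m (geom_mat m X k) (of_nat k \<cdot>\<^sub>m 1\<^sub>m m)" for k
  proof (induction k)
    case 0
    show ?case using mats_over_closed(2) by (auto simp: mat_cong_def ideal_zero)
  next
    case (Suc k)
    have "geom_mat m X (Suc k) \<in> mats_over m A"
      using Suc pow_mats_over[OF X(1)] by (auto intro: mats_over_closed)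
    moreover have "geom_mat m X (Suc k) $$ (i, j) - (of_nat (Suc k) \<cdot>\<^sub>m 1\<^sub>m m) $$ (i, j) \<in> P"
      if ij: "i < m" "j < m" for i j
    proof -
      have "(geom_mat m X k $$ (i, j) - (of_nat k \<cdot>\<^sub>m 1\<^sub>m m) $$ (i, j)) + ((X ^\<^sub>m k) $$ (i, j) - 1\<^sub>m m $$ (i, j)) \<in> P"
        using Suc mat_cong_pow[OF X, of k] ij unfolding mat_cong_def by (intro ideal_add) blast+
      then show ?thesis using XC ij geom_mat_carrier[OF XC, of k] by (simp add: algebra_simps)
    qed
    ultimately show ?case by (simp add: mat_cong_def)
  qed
  have "of_nat r \<cdot>\<^sub>m 1\<^sub>m m \<in> mats_over m A"
    by (auto simp: mats_over_def of_nat one zero)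
  then have d: "det N - of_nat r ^ m \<in> P"
    using mat_cong_det[of N m "of_nat r \<cdot>\<^sub>m 1\<^sub>m m"] geom[of r] by (simp add: N_def)
  have "det N \<noteq> 0"
  proof
    assume "det N = 0"
    then have "of_nat r ^ m \<in> P" using d ideal_uminus_iff by simp
    then show False using prime_power[OF of_nat] r(2) by blast
  qed
  have X1: "X - 1\<^sub>m m \<in> carrier_mat m m" by (rule minus_carrier_mat[OF one_carrier_mat])
  \<comment> \<open>The adjugate of \<open>N\<close> turns \<open>N (X - 1) = 0\<close> into
    \<open>det N (X - 1) = 0\<close>, and the nonzero scalar \<open>det N\<close> can be cancelled
    in the field.\<close>
  have "det N \<cdot>\<^sub>m (X - 1\<^sub>m m) = (det N \<cdot>\<^sub>m 1\<^sub>m m) * (X - 1\<^sub>m m)"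
    using mult_smult_assoc_mat[OF one_carrier_mat X1] X1 by simp
  also have "\<dots> = adj_mat N * (N * (X - 1\<^sub>m m))"
    using assoc_mult_mat[OF adj_mat(1)[OF NC] NC X1] adj_mat(3)[OF NC] by simp
  also have "N * (X - 1\<^sub>m m) = 0\<^sub>m m m"
    unfolding N_def geom_mat_telescope[OF XC] r(1) by auto
  also have "adj_mat N * 0\<^sub>m m m = 0\<^sub>m m m" using adj_mat(1)[OF NC] by simp
  finally have eq: "det N \<cdot>\<^sub>m (X - 1\<^sub>m m) = 0\<^sub>m m m" .
  show ?thesis
  proof (rule eq_matI)
    fix i j assume "i < dim_row (1\<^sub>m m :: 'a mat)" "j < dim_col (1\<^sub>m m :: 'a mat)"
    then have ij: "i < m" "j < m" by auto
    have "(det N \<cdot>\<^sub>m (X - 1\<^sub>m m)) $$ (i, j) = 0" unfolding eq using ij by simp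
    then have "det N * (X $$ (i, j) - 1\<^sub>m m $$ (i, j)) = 0" using XC ij by simp
    then show "X $$ (i, j) = 1\<^sub>m m $$ (i, j)" using \<open>det N \<noteq> 0\<close> by simp
  qed (use XC in auto)
qed

section \<open>Action of matrices on vectors, and unipotence\<close>

definition mat_act :: "nat \<Rightarrow> 'a::comm_ring_1 mat \<Rightarrow> (nat \<Rightarrow> 'a) \<Rightarrow> nat \<Rightarrow> 'a" where
  "mat_act m X v = (\<lambda>i. if i < m then \<Sum>k<m. X $$ (i, k) * v k else 0)"

lemma mat_act_mult:
  assumes "X \<in> carrier_mat m m" "Y \<in> carrier_mat m m"
  shows "mat_act m (X * Y) v = mat_act m X (mat_act m Y v)"
proof
  fix i
  have "(\<Sum>k<m. (X * Y) $$ (i, k) * v k) = (\<Sum>k<m. X $$ (i, k) * (\<Sum>l<m. Y $$ (k, l) * v l))" if i: "i < m"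
  proof -
    have "(\<Sum>k<m. (X * Y) $$ (i, k) * v k) = (\<Sum>k<m. \<Sum>l<m. X $$ (i, l) * Y $$ (l, k) * v k)"
      using assms i by (simp add: index_mult_mat_sum sum_distrib_right del: index_mult_mat(1))
    also have "\<dots> = (\<Sum>l<m. \<Sum>k<m. X $$ (i, l) * Y $$ (l, k) * v k)" by (rule sum.swap)
    also have "\<dots> = (\<Sum>l<m. X $$ (i, l) * (\<Sum>k<m. Y $$ (l, k) * v k))"
      by (simp add: sum_distrib_left mult.assoc)
    finally show ?thesis .
  qed
  then show "mat_act m (X * Y) v i = mat_act m X (mat_act m Y v) i" by (simp add: mat_act_def)
qed

lemma mat_act_one: "v \<in> vecs m S \<Longrightarrow> mat_act m (1\<^sub>m m) v = v"
proof
  fix i assume v: "v \<in> vecs m S"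
  have "(\<Sum>k<m. 1\<^sub>m m $$ (i, k) * v k) = (\<Sum>k<m. if k = i then v k else 0)" if "i < m"
    using that by (intro sum.cong) auto
  then show "mat_act m (1\<^sub>m m) v i = v i" using vecsD(2)[OF v] by (simp add: mat_act_def sum.delta)
qed

lemma mat_act_diff_one:
  assumes "X \<in> carrier_mat m m" "v \<in> vecs m S"
  shows "mat_act m (X - 1\<^sub>m m) v = mat_act m X v - v"
proof -
  have "mat_act m (X - 1\<^sub>m m) v = mat_act m X v - mat_act m (1\<^sub>m m) v"
    using assms(1) by (auto simp: mat_act_def fun_eq_iff left_diff_distrib simp flip: sum_subtractf)
  then show ?thesis using mat_act_one[OF assms(2)] by simp
qed

lemma (in coeff_ideal) mat_act_closed: "X \<in> mats_over m A \<Longrightarrow> v \<in> vecs m I \<Longrightarrow> mat_act m X v \<in> vecs m I"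
  by (rule vecsI) (auto simp: mat_act_def intro!: ideal_sum absorb dest: mats_overD vecsD)

lemma mat_act_unit: "i < m \<Longrightarrow> j < m \<Longrightarrow> mat_act m X (\<lambda>k. if k = j then 1 else 0) i = X $$ (i, j)"
  by (simp add: mat_act_def if_distrib cong: if_cong)

text \<open>Unipotence of a set of matrices is expressed by the vanishing of all such products of
  length \<open>m\<close>.\<close>

definition diff_one_prod :: "nat \<Rightarrow> 'a::comm_ring_1 mat list \<Rightarrow> 'a mat" where
  "diff_one_prod m Xs = foldr (\<lambda>X Y. (X - 1\<^sub>m m) * Y) Xs (1\<^sub>m m)"

lemma diff_one_prod_simps:
  "diff_one_prod m [] = 1\<^sub>m m" "diff_one_prod m (X # Xs) = (X - 1\<^sub>m m) * diff_one_prod m Xs"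
  by (simp_all add: diff_one_prod_def)

lemma diff_one_prod_carrier: "diff_one_prod m Xs \<in> carrier_mat m m"
proof (induction Xs)
  case (Cons X Xs)
  have "X - 1\<^sub>m m \<in> carrier_mat m m" by (rule minus_carrier_mat[OF one_carrier_mat])
  from mult_carrier_mat[OF this Cons] show ?case by (simp add: diff_one_prod_simps)
qed (simp add: diff_one_prod_simps)

text \<open>\<open>X - 1\<close> maps each term of the fixed-point filtration into the preceding
  one, so \<open>m\<close> factors take \<open>U m\<close>, which is everything, into
  \<open>U 0\<close>, the vectors over \<open>P\<close>.\<close>

lemma (in finite_prime) unipotent_diff_one_prod:
  assumes K: "K \<subseteq> mats_over m A" "1\<^sub>m m \<in> K" "\<And>X Y. X \<in> K \<Longrightarrow> Y \<in> K \<Longrightarrow> X * Y \<in> K"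
    and p: "prime p" "of_nat p \<in> P" "\<And>X. X \<in> K \<Longrightarrow> \<exists>k. X ^\<^sub>m (p ^ k) = 1\<^sub>m m"
    and Xs: "set Xs \<subseteq> K" "length Xs = m" and ij: "i < m" "j < m"
  shows "diff_one_prod m Xs $$ (i, j) \<in> P"
proof -
  have KC: "X \<in> carrier_mat m m" if "X \<in> K" for X using K(1) mats_overD(1) that by blast
  have PA: "vecs m P \<subseteq> vecs m A" using subset unfolding vecs_def by auto
  \<comment> \<open>Agreement is tested on \<open>vecs m A\<close> only: the action of
    \<open>1\<^sub>m m\<close> truncates other functions, and \<open>id\<close> has to belong to
    \<open>F\<close>.\<close>
  define F where "F = {f. \<exists>X\<in>K. \<forall>v\<in>vecs m A. f v = mat_act m X v}"
  define U where "U = rec_nat (vecs m P) (\<lambda>_ V. {v \<in> vecs m A. \<forall>f\<in>F. f v - v \<in> V})"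
  have U: "U 0 = vecs m P" "\<And>i. U (Suc i) = {v \<in> vecs m A. \<forall>f\<in>F. f v - v \<in> U i}"
    by (simp_all add: U_def)
  have "U m = vecs m A"
  proof (rule fixed_point_filtration[OF p(1,2) _ _ _ _ _ _ _ U])
    show "id \<in> F" unfolding F_def using K(2) by (auto simp: mat_act_one intro!: bexI[of _ "1\<^sub>m m"])
  next
    fix f g assume "f \<in> F" "g \<in> F"
    then obtain X Y where X: "X \<in> K" "\<forall>v\<in>vecs m A. f v = mat_act m X v"
      and Y: "Y \<in> K" "\<forall>v\<in>vecs m A. g v = mat_act m Y v" unfolding F_def by blast
    have "(f \<circ> g) v = mat_act m (X * Y) v" if "v \<in> vecs m A" for v
    proof -
      have "mat_act m Y v \<in> vecs m A" using self.mat_act_closed that Y(1) K(1) by blast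
      then show ?thesis using X(2) Y(2) that mat_act_mult[OF KC[OF X(1)] KC[OF Y(1)]] by simp
    qed
    then show "f \<circ> g \<in> F" unfolding F_def using K(3)[OF X(1) Y(1)] by blast
  next
    fix f assume "f \<in> F"
    then obtain X where X: "X \<in> K" "\<forall>v\<in>vecs m A. f v = mat_act m X v" unfolding F_def by blast
    have XA: "X \<in> mats_over m A" using X(1) K(1) by blast
    show fA: "f ` vecs m A \<subseteq> vecs m A" using X(2) self.mat_act_closed[OF XA] by auto
    show "f ` vecs m P \<subseteq> vecs m P" using X(2) mat_act_closed[OF XA] PA by auto
    show "f (v - w) = f v - f w" if "v \<in> vecs m A" "w \<in> vecs m A" for v w
      using X(2) that self.vecs_closed(2)[OF that]
      by (auto simp: mat_act_def fun_eq_iff right_diff_distrib simp flip: sum_subtractf)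
    show "f (\<lambda>i. a * v i) = (\<lambda>i. a * f v i)" if "v \<in> vecs m A" "a \<in> A" for v a
      using X(2) that self.vecs_closed(4)[OF that(2,1)]
      by (auto simp: mat_act_def fun_eq_iff sum_distrib_left mult.left_commute)
    have pow: "(f ^^ n) v = mat_act m (X ^\<^sub>m n) v \<and> (f ^^ n) v \<in> vecs m A" if "v \<in> vecs m A" for v n
      using that
    proof (induction n arbitrary: v)
      case 0
      then show ?case using mat_act_one[OF 0] KC[OF X(1)] by simp
    next
      case (Suc n)
      have "f v \<in> vecs m A" using fA Suc.prems by blast
      note IH = Suc.IH[OF this]
      have eq1: "(f ^^ Suc n) v = (f ^^ n) (f v)" by (simp add: funpow_swap1)
      have eq2: "mat_act m (X ^\<^sub>m Suc n) v = mat_act m (X ^\<^sub>m n) (f v)"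
        using X(2) Suc.prems mat_act_mult[of "X ^\<^sub>m n" m X] KC[OF X(1)] by simp
      show ?case unfolding eq1 eq2 by (rule IH)
    qed
    obtain k where "X ^\<^sub>m (p ^ k) = 1\<^sub>m m" using p(3)[OF X(1)] by blast
    then have "(f ^^ (p ^ k)) v = v" if "v \<in> vecs m A" for v using pow[OF that, of "p ^ k"] mat_act_one[OF that] by simp
    then show "\<exists>k. \<forall>v\<in>vecs m A. (f ^^ (p ^ k)) v = v" by blast
  qed
  moreover have "mat_act m (diff_one_prod m Xs) v \<in> U n"
    if "set Xs \<subseteq> K" "v \<in> vecs m A" "v \<in> U (n + length Xs)" for Xs v n
    using that
  proof (induction Xs arbitrary: n)
    case Nil
    then show ?case using mat_act_one[OF Nil.prems(2)] by (simp add: diff_one_prod_simps)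
  next
    case (Cons X Xs)
    have XK: "X \<in> K" using Cons.prems by simp
    define w where "w = mat_act m (diff_one_prod m Xs) v"
    have w: "w \<in> U (Suc n)" unfolding w_def using Cons.IH[of "Suc n"] Cons.prems by simp
    then have wA: "w \<in> vecs m A" unfolding U(2) by blast
    have X1: "X - 1\<^sub>m m \<in> carrier_mat m m" by (rule minus_carrier_mat[OF one_carrier_mat])
    have "mat_act m (diff_one_prod m (X # Xs)) v = mat_act m (X - 1\<^sub>m m) w"
      unfolding w_def diff_one_prod_simps by (rule mat_act_mult[OF X1 diff_one_prod_carrier])
    also have "\<dots> = mat_act m X w - w" by (rule mat_act_diff_one[OF KC[OF XK] wA])
    also have "\<dots> \<in> U n"
    proof -
      have "mat_act m X \<in> F" unfolding F_def using XK by blast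
      then show ?thesis using w unfolding U(2) by blast
    qed
    finally show ?case .
  qed
  \<comment> \<open>A unit vector extracts the \<open>j\<close>-th column.\<close>
  moreover have e: "(\<lambda>k. if k = j then 1 else 0) \<in> vecs m A" using ij by (auto intro!: vecsI simp: one zero)
  ultimately have "mat_act m (diff_one_prod m Xs) (\<lambda>k. if k = j then 1 else 0) \<in> vecs m P"
    unfolding U(1)[symmetric] using Xs by simp
  from vecsD(1)[OF this ij(1)] show ?thesis unfolding mat_act_unit[OF ij] .
qed

section \<open>Finite additive spans and the residue characteristic\<close>

text \<open>Only additions occur, which suffices in characteristic \<open>p\<close>, where negatives
  and prime-field multiples are repeated sums.\<close>

inductive_set add_span :: "nat \<Rightarrow> 'a::comm_ring_1 mat set \<Rightarrow> 'a mat set" for m V where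
  zero: "0\<^sub>m m m \<in> add_span m V"
| add: "X \<in> add_span m V \<Longrightarrow> w \<in> V \<Longrightarrow> X + w \<in> add_span m V"

lemma add_span_carrier: "X \<in> add_span m V \<Longrightarrow> V \<subseteq> carrier_mat m m \<Longrightarrow> X \<in> carrier_mat m m"
  by (induction rule: add_span.induct) auto

lemma add_span_closed:
  assumes V: "V \<subseteq> carrier_mat m m" and "X \<in> add_span m V" "Y \<in> add_span m V"
  shows "X + Y \<in> add_span m V"
  using assms(3)
proof induction
  case zero
  show ?case using add_span_carrier[OF assms(2) V] assms(2) by simp
next
  case (add Y w)
  have "X + (Y + w) = (X + Y) + w"
    using add_span_carrier[OF assms(2) V] add_span_carrier[OF add(1) V] add(2) V
    by (intro assoc_add_mat[symmetric]) auto
  then show ?case using add_span.add[OF add(3,2)] by (simp only:)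
qed

lemma add_span_base:
  assumes "V \<subseteq> carrier_mat m m" "w \<in> V"
  shows "w \<in> add_span m V"
proof -
  have "w = 0\<^sub>m m m + w" using assms by auto
  then show ?thesis using add_span.add[OF add_span.zero assms(2), of m] by (simp only:)
qed

text \<open>An element of the span is determined by how often each generator occurs, and these
  multiplicities matter only modulo \<open>p\<close>.\<close>

lemma finite_add_span:
  assumes V: "finite V" "V \<subseteq> carrier_mat m m" and p: "p > 0" "of_nat p = (0 :: 'a::comm_ring_1)"
  shows "finite (add_span m (V :: 'a mat set))"
proof -
  define lin where "lin c = mat m m (\<lambda>ij. \<Sum>w\<in>V. of_nat (c w) * w $$ ij)" for c :: "'a mat \<Rightarrow> nat"
  have of_nat_mod: "(of_nat (n mod p) :: 'a) = of_nat n" for n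
  proof -
    have "(of_nat (p * (n div p) + n mod p) :: 'a) = of_nat (n mod p)"
      using p(2) by (simp only: of_nat_add of_nat_mult) simp
    then show ?thesis by simp
  qed
  have "add_span m V \<subseteq> range lin"
  proof
    fix X assume "X \<in> add_span m V"
    then show "X \<in> range lin"
    proof induction
      case zero
      have eq: "0\<^sub>m m m = lin (\<lambda>_. 0)" by (auto simp: lin_def)
      show ?case unfolding eq by (rule rangeI)
    next
      case (add X w)
      from add(3) obtain c where c: "X = lin c" by (rule rangeE)
      have eq: "X + w = lin (c(w := Suc (c w)))"
      proof (rule eq_matI)
        fix i j assume "i < dim_row (lin (c(w := Suc (c w))))" "j < dim_col (lin (c(w := Suc (c w))))"
        then have ij: "i < m" "j < m" by (auto simp: lin_def)
        have "(\<Sum>v\<in>V. of_nat ((c(w := Suc (c w))) v) * v $$ (i, j)) =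
            (\<Sum>v\<in>V. of_nat (c v) * v $$ (i, j) + (if v = w then w $$ (i, j) else 0))"
          by (rule sum.cong) (auto simp: algebra_simps)
        also have "\<dots> = (\<Sum>v\<in>V. of_nat (c v) * v $$ (i, j)) + w $$ (i, j)"
          using V(1) add(2) by (simp add: sum.distrib)
        finally show "(X + w) $$ (i, j) = lin (c(w := Suc (c w))) $$ (i, j)"
          using ij V(2) add(2) by (auto simp: c lin_def)
      qed (use V(2) add(2) in \<open>auto simp: c lin_def\<close>)
      show ?case unfolding eq by (rule rangeI)
    qed
  qed
  also have "range lin \<subseteq> lin ` (V \<rightarrow>\<^sub>E {..<p})"
  proof
    fix X assume "X \<in> range lin"
    then obtain c where c: "X = lin c" by (rule rangeE)
    have "X = lin (\<lambda>w\<in>V. c w mod p)"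
      unfolding c lin_def by (simp add: of_nat_mod)
    moreover have "(\<lambda>w\<in>V. c w mod p) \<in> V \<rightarrow>\<^sub>E {..<p}" using p(1) by auto
    ultimately show "X \<in> lin ` (V \<rightarrow>\<^sub>E {..<p})" by (rule image_eqI)
  qed
  finally have sub: "add_span m V \<subseteq> lin ` (V \<rightarrow>\<^sub>E {..<p})" .
  have "finite (V \<rightarrow>\<^sub>E {..<p})" using V(1) by (simp add: finite_PiE)
  then show ?thesis by (rule finite_subset[OF sub finite_imageI])
qed

text \<open>Two integers collide in the finite residue ring. The least positive integer in
  \<open>P\<close> has a prime factor in \<open>P\<close>, and Bezout's identity excludes every
  integer not divisible by it.\<close>

lemma (in finite_prime) ex_residue_characteristic:
  "\<exists>p. prime p \<and> of_nat p \<in> P \<and> (\<forall>r. \<not> p dvd r \<longrightarrow> of_nat r \<notin> P)"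
proof -
  have "\<not> inj_on (\<lambda>k::nat. rep (of_nat k)) UNIV"
  proof
    assume "inj_on (\<lambda>k::nat. rep (of_nat k)) UNIV"
    moreover have "range (\<lambda>k::nat. rep (of_nat k)) \<subseteq> rep ` A" using of_nat by auto
    ultimately show False using finite_index unfolding finite_index_def
      by (meson finite_imageD finite_subset infinite_UNIV_nat)
  qed
  then obtain i j :: nat where "i < j" and "rep (of_nat j) = rep (of_nat i)"
    unfolding inj_on_def by (metis linorder_neqE_nat)
  then have "of_nat j - of_nat i \<in> P" using rep_eq_iff of_nat by blast
  then have "of_nat (j - i) \<in> P" using \<open>i < j\<close> by (simp add: of_nat_diff)
  then have ex: "\<exists>n. n > 0 \<and> of_nat n \<in> P" using \<open>i < j\<close> by (intro exI[of _ "j - i"]) simp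
  define n where "n = (LEAST n. n > 0 \<and> of_nat n \<in> P)"
  have n: "n > 0" "of_nat n \<in> P" using LeastI_ex[OF ex] by (auto simp: n_def)
  have least: "n \<le> k" if "k > 0" "of_nat k \<in> P" for k
    using Least_le[of "\<lambda>n. n > 0 \<and> of_nat n \<in> P" k] that by (simp add: n_def)
  have "n \<noteq> 1" using n proper by auto
  then obtain p where p: "prime p" "p dvd n" using prime_factor_nat by blast
  then obtain b where b: "n = p * b" by (elim dvdE)
  have "of_nat p \<in> P"
  proof (rule ccontr)
    assume "of_nat p \<notin> P"
    then have "of_nat b \<in> P" using prime[of "of_nat p" "of_nat b"] n(2) of_nat by (auto simp: b)
    then have "n \<le> b" using least n(1) b by auto
    then show False using b n(1) prime_gt_1_nat[OF p(1)] by auto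
  qed
  moreover have "of_nat r \<notin> P" if "\<not> p dvd r" for r
  proof
    assume "of_nat r \<in> P"
    have "coprime r p" using that p(1) by (metis coprime_commute prime_imp_coprime)
    moreover have "r \<noteq> 0" using that by (intro notI) simp
    ultimately obtain x y where xy: "r * x = p * y + 1" using bezout_nat[of r p] by auto
    have "(1 :: 'a) = of_nat x * of_nat r - of_nat y * of_nat p"
      using arg_cong[OF xy, of "of_nat :: nat \<Rightarrow> 'a"] by (simp add: algebra_simps)
    also have "\<dots> \<in> P" using \<open>of_nat r \<in> P\<close> \<open>of_nat p \<in> P\<close> by (intro ideal_diff absorb of_nat)
    finally show False using proper by blast
  qed
  ultimately show ?thesis using p(1) by blast
qed

definition (in coeff_ideal) mat_rep :: "nat \<Rightarrow> 'a mat \<Rightarrow> 'a mat" where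
  "mat_rep m X = mat m m (\<lambda>ij. rep (X $$ ij))"

lemma (in coeff_ideal) mat_rep_eq_iff:
  assumes "X \<in> mats_over m A" "Y \<in> mats_over m A"
  shows "mat_rep m X = mat_rep m Y \<longleftrightarrow> mat_cong m X Y"
proof -
  have "mat_rep m X = mat_rep m Y \<longleftrightarrow> (\<forall>i<m. \<forall>j<m. rep (X $$ (i, j)) = rep (Y $$ (i, j)))"
    by (auto simp: mat_rep_def mat_eq_iff)
  then show ?thesis using assms[THEN mats_overD(2)] by (simp add: mat_cong_def rep_eq_iff)
qed

lemma (in finite_prime) finite_mat_rep: "finite (mat_rep m ` mats_over m A)"
proof (rule finite_subset)
  show "mat_rep m ` mats_over m A \<subseteq> mats_over m (rep ` A)"
    by (auto simp: mats_over_def mat_rep_def)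
  show "finite (mats_over m (rep ` A))"
    using finite_index finite_mats_over unfolding finite_index_def by blast
qed

section \<open>Groups of matrices over a field\<close>

text \<open>Inverses are those of the abstract group, so no theory of inverse matrices enters, and
  homomorphic images of other groups fit directly.\<close>

locale matrix_group = group G for G :: "'f::field mat monoid" (structure) +
  fixes m :: nat
  assumes carrier_subset: "carrier G \<subseteq> carrier_mat m m"
    and mult_eq: "x \<in> carrier G \<Longrightarrow> y \<in> carrier G \<Longrightarrow> x \<otimes> y = x * y"
    and one_eq: "\<one> = 1\<^sub>m m"
begin

lemma pow_eq: "x \<in> carrier G \<Longrightarrow> x [^] (k::nat) = x ^\<^sub>m k"
proof (induction k)
  case 0
  then have "dim_row x = m" using carrier_subset by auto
  then show ?case by (simp add: one_eq)
next
  case (Suc k)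
  have "x [^] k \<in> carrier G" using Suc.prems by (rule nat_pow_closed)
  from mult_eq[OF this Suc.prems] show ?case using Suc by simp
qed

lemma generate_mats_over:
  assumes "coeff_ring A" "S \<subseteq> carrier G" "S \<union> m_inv G ` S \<subseteq> mats_over m A"
  shows "generate G S \<subseteq> mats_over m A"
proof
  interpret coeff_ring A by fact
  fix x assume "x \<in> generate G S"
  then show "x \<in> mats_over m A"
  proof induction
    case one
    show ?case unfolding one_eq by (rule mats_over_closed)
  next
    case (incl h)
    then show ?case using assms(3) by blast
  next
    case (inv h)
    then show ?case using assms(3) by blast
  next
    case (eng g h)
    have "g \<otimes> h = g * h" using generate_in_carrier[OF assms(2)] eng by (intro mult_eq) auto
    then show ?case using mats_over_closed(5)[OF eng(3,4)] by simp
  qed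
qed

text \<open>The elements of the generated group are combinations, with coefficients in the prime field,
  of the finitely many nonvanishing products of the matrices \<open>y - 1\<close>.\<close>

lemma finite_generate_unipotent:
  assumes Y: "finite Y" "Y \<subseteq> carrier G" "m_inv G ` Y \<subseteq> Y"
    and p: "p > 0" "of_nat p = (0 :: 'f)"
    and nil: "\<And>Xs. set Xs \<subseteq> Y \<Longrightarrow> length Xs = m \<Longrightarrow> diff_one_prod m Xs = 0\<^sub>m m m"
  shows "finite (generate G Y)"
proof -
  \<comment> \<open>The empty list contributes the identity. Products of length \<open>m\<close> are
    already 0, so multiplying an element of \<open>W\<close> by \<open>y - 1\<close> gives an
    element of \<open>W\<close> or 0.\<close>
  define W where "W = diff_one_prod m ` {Xs. set Xs \<subseteq> Y \<and> length Xs \<le> m}"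
  define E where "E = add_span m W"
  have W: "finite W" "W \<subseteq> carrier_mat m m"
    unfolding W_def using finite_lists_length_le[OF Y(1)] diff_one_prod_carrier by auto
  have YC: "y \<in> carrier_mat m m" if "y \<in> Y" for y using that Y(2) carrier_subset by blast
  \<comment> \<open>\<open>y * w\<close> is the sum of \<open>(y - 1) * w\<close> and
    \<open>w\<close>, and the first summand is 0 or a product with one more factor.\<close>
  have yw: "y * w \<in> E" if y: "y \<in> Y" and w: "w \<in> W" for y w
  proof -
    have y1: "y - 1\<^sub>m m \<in> carrier_mat m m" by (rule minus_carrier_mat[OF one_carrier_mat])
    have wC: "w \<in> carrier_mat m m" using W w by blast
    obtain Xs where Xs: "set Xs \<subseteq> Y" "length Xs \<le> m" "w = diff_one_prod m Xs"
      using w unfolding W_def by blast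
    have "(y - 1\<^sub>m m) * w \<in> E"
    proof (cases "length Xs = m")
      case True
      then have "(y - 1\<^sub>m m) * w = 0\<^sub>m m m" using nil[OF Xs(1)] Xs(3) right_mult_zero_mat[OF y1] by simp
      then show ?thesis unfolding E_def using add_span.zero by simp
    next
      case False
      then have "diff_one_prod m (y # Xs) \<in> W" unfolding W_def using Xs y by (intro imageI) auto
      then show ?thesis unfolding E_def Xs(3) using add_span_base[OF W(2)] by (simp add: diff_one_prod_simps)
    qed
    moreover have "w \<in> E" unfolding E_def by (rule add_span_base[OF W(2) w])
    ultimately have "(y - 1\<^sub>m m) * w + w \<in> E" unfolding E_def by (intro add_span_closed[OF W(2)])
    moreover have "(y - 1\<^sub>m m) * w + w = y * w"
      unfolding minus_mult_distrib_mat[OF YC[OF y] one_carrier_mat wC] left_mult_one_mat[OF wC]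
      using YC[OF y] wC by (intro eq_matI) (auto simp del: index_mult_mat(1))
    ultimately show ?thesis by simp
  qed
  have yE: "y * X \<in> E" if "y \<in> Y" "X \<in> E" for y X
    using that(2) unfolding E_def
  proof induction
    case zero
    show ?case using right_mult_zero_mat[OF YC[OF that(1)]] add_span.zero by simp
  next
    case (add X w)
    have "y * (X + w) = y * X + y * w"
      using YC[OF that(1)] add_span_carrier[OF add(1) W(2)] add(2) W(2) by (intro mult_add_distrib_mat) auto
    then show ?case using add_span_closed[OF W(2) add(3)] yw[OF that(1) add(2)] by (simp add: E_def)
  qed
  \<comment> \<open>The span is stable under left multiplication by the group; letting the group act
    on the identity, which lies in \<open>E\<close>, places the group inside
    \<open>E\<close>.\<close>
  have gen: "h * X \<in> E" if "h \<in> generate G Y" "X \<in> E" for h X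
    using that
  proof (induction arbitrary: X)
    case one
    then show ?case using add_span_carrier[OF _ W(2)] unfolding one_eq E_def by (metis left_mult_one_mat)
  next
    case (incl h)
    then show ?case using yE by blast
  next
    case (inv h)
    then show ?case using yE Y(3) by blast
  next
    case (eng g h)
    have gh: "g \<in> carrier G" "h \<in> carrier G" using generate_in_carrier[OF Y(2)] eng by auto
    have "g \<otimes> h * X = g * (h * X)" unfolding mult_eq[OF gh]
      using gh carrier_subset add_span_carrier[OF _ W(2)] eng(5) unfolding E_def
      by (intro assoc_mult_mat) auto
    then show ?case using eng by simp
  qed
  have "1\<^sub>m m \<in> W" unfolding W_def by (rule image_eqI[of _ _ "[]"]) (simp_all add: diff_one_prod_simps)
  then have "1\<^sub>m m \<in> E" unfolding E_def by (rule add_span_base[OF W(2)])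
  have "generate G Y \<subseteq> E"
  proof
    fix h assume h: "h \<in> generate G Y"
    then have "h \<in> carrier_mat m m" using generate_in_carrier[OF Y(2)] carrier_subset by blast
    then show "h \<in> E" using gen[OF h \<open>1\<^sub>m m \<in> E\<close>] by simp
  qed
  then show ?thesis unfolding E_def by (rule finite_subset) (rule finite_add_span[OF W p])
qed

text \<open>Splits off the \<open>p\<close>-part of the exponent \<open>k\<close>: the power
  \<open>x [^] (p ^ a)\<close> is still congruent to 1 and is killed by an exponent prime to
  \<open>p\<close>, which is nonzero modulo \<open>P\<close>.\<close>

lemma congruence_kernel_prime_power:
  assumes "finite_prime A P" "carrier G \<subseteq> mats_over m A"
    and p: "prime p" "\<And>r. \<not> p dvd r \<Longrightarrow> of_nat r \<notin> P"
    and x: "x \<in> carrier G" "coeff_ideal.mat_cong P m x \<one>" "k > 0" "x [^] (k::nat) = \<one>"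
  shows "\<exists>a. x [^] (p ^ a) = \<one>"
proof -
  interpret finite_prime A P by fact
  obtain r where r: "k = p ^ multiplicity p k * r" "\<not> p dvd r"
    using multiplicity_decompose'[of k p] x(3) p(1) not_prime_unit[of p] by (metis less_numeral_extra(3))
  define a where "a = multiplicity p k"
  define y where "y = x [^] (p ^ a)"
  have yG: "y \<in> carrier G" using x by (simp add: y_def)
  have "y ^\<^sub>m r = y [^] r" by (rule pow_eq[OF yG, symmetric])
  also have "\<dots> = x [^] k" unfolding y_def using nat_pow_pow[OF x(1)] r(1) by (simp add: a_def)
  also have "\<dots> = 1\<^sub>m m" using x(4) one_eq by simp
  finally have "y ^\<^sub>m r = 1\<^sub>m m" .
  moreover have "mat_cong m y (1\<^sub>m m)"
    unfolding y_def pow_eq[OF x(1)] using x(1,2) assms(2) by (intro mat_cong_pow) (auto simp: one_eq)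
  ultimately have "y = 1\<^sub>m m" using congruence_kernel_torsion yG assms(2) p(2)[OF r(2)] by blast
  then show ?thesis unfolding y_def one_eq by blast
qed

end

section \<open>Periodic matrix groups over a field\<close>

context matrix_group
begin

text \<open>Makes the fibres of reduction the cosets of the congruence kernel, without forming a
  reduced group.\<close>

lemma cong_one_iff:
  assumes "coeff_ideal A P" "carrier G \<subseteq> mats_over m A" "x \<in> carrier G" "y \<in> carrier G"
  shows "coeff_ideal.mat_cong P m (inv x \<otimes> y) \<one> \<longleftrightarrow> coeff_ideal.mat_cong P m x y"
proof -
  interpret coeff_ideal A P by fact
  have left: "mat_cong m (z \<otimes> x) (z \<otimes> y)"
    if "mat_cong m x y" "x \<in> carrier G" "y \<in> carrier G" "z \<in> carrier G" for x y z
    using that assms(2) unfolding mult_eq[OF that(4,2)] mult_eq[OF that(4,3)]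
    by (intro mat_cong_mult mat_cong_refl) auto
  show ?thesis
  proof
    assume "mat_cong m (inv x \<otimes> y) \<one>"
    then have "mat_cong m (x \<otimes> (inv x \<otimes> y)) (x \<otimes> \<one>)"
      by (rule left) (simp_all add: assms(3,4))
    moreover have "x \<otimes> (inv x \<otimes> y) = y" "x \<otimes> \<one> = x"
      using assms(3,4) by (simp_all add: m_assoc[symmetric])
    ultimately show "mat_cong m x y" using mat_cong_sym by simp
  next
    assume "mat_cong m x y"
    then have "mat_cong m (inv x \<otimes> y) (inv x \<otimes> x)"
      by (intro left[OF mat_cong_sym]) (simp_all add: assms(3,4))
    then show "mat_cong m (inv x \<otimes> y) \<one>" using assms(3) by simp
  qed
qed

lemma subgroup_congruence_kernel:
  assumes "coeff_ideal A P" "carrier G \<subseteq> mats_over m A"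
  shows "subgroup {x \<in> carrier G. coeff_ideal.mat_cong P m x \<one>} G"
proof (rule subgroupI)
  interpret coeff_ideal A P by fact
  show "{x \<in> carrier G. mat_cong m x \<one>} \<noteq> {}" using mat_cong_refl by blast
next
  interpret coeff_ideal A P by fact
  fix a assume a: "a \<in> {x \<in> carrier G. mat_cong m x \<one>}"
  then have "mat_cong m (inv a \<otimes> \<one>) \<one>" using cong_one_iff[OF assms, of a \<one>] by blast
  then show "inv a \<in> {x \<in> carrier G. mat_cong m x \<one>}" using a by simp
next
  interpret coeff_ideal A P by fact
  fix a b assume ab: "a \<in> {x \<in> carrier G. mat_cong m x \<one>}" "b \<in> {x \<in> carrier G. mat_cong m x \<one>}"
  then have "mat_cong m (a * b) (\<one> * \<one>)" using assms(2) by (intro mat_cong_mult) auto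
  then have "mat_cong m (a \<otimes> b) \<one>" using ab mult_eq[of a b] mult_eq[of \<one> \<one>] by simp
  moreover have "a \<otimes> b \<in> carrier G" using ab by blast
  ultimately show "a \<otimes> b \<in> {x \<in> carrier G. mat_cong m x \<one>}" by blast
qed auto

text \<open>The Burnside-Schur theorem over an arbitrary field.\<close>

theorem finite_carrier_of_torsion:
  assumes S: "finite S" "S \<subseteq> carrier G" "generate G S = carrier G"
    and tors: "\<And>x. x \<in> carrier G \<Longrightarrow> \<exists>k>0. x [^] (k::nat) = \<one>"
  shows "finite (carrier G)"
proof -
  \<comment> \<open>A subring need not contain the entries of inverse matrices, so the inverses of
    the generators contribute their entries too.\<close>
  define S' where "S' = S \<union> m_inv G ` S"
  have S': "finite S'" "S' \<subseteq> carrier G" using S by (auto simp: S'_def)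
  define Ent where "Ent = (\<Union>X\<in>S'. (\<lambda>(i, j). X $$ (i, j)) ` ({..<m} \<times> {..<m}))"
  have "finite Ent" unfolding Ent_def using S'(1) by (intro finite_UN_I) auto
  then obtain A where A: "coeff_ring A \<and> Ent \<subseteq> A \<and>
      (\<forall>b\<in>A. b \<noteq> 0 \<longrightarrow> (\<exists>P. finite_prime A P \<and> b \<notin> P))"
    using ex_coeff_ring_finite_primes by blast
  interpret coeff_ring A using A by blast
  have ex_prime: "\<exists>P. finite_prime A P \<and> b \<notin> P" if "b \<in> A" "b \<noteq> 0" for b using A that by blast
  have "S' \<subseteq> mats_over m A"
  proof
    fix X assume X: "X \<in> S'"
    then have "X $$ (i, j) \<in> Ent" if "i < m" "j < m" for i j
      unfolding Ent_def using that by (intro UN_I[OF X]) auto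
    then show "X \<in> mats_over m A"
      using X S'(2) carrier_subset A unfolding mats_over_def by blast
  qed
  then have GA: "carrier G \<subseteq> mats_over m A"
    using generate_mats_over[OF coeff_ring_axioms S(2)] S(3) by (simp add: S'_def)
  obtain P where "finite_prime A P" using ex_prime[of 1] one by auto
  then interpret P: finite_prime A P .
  obtain p where p: "prime p" "of_nat p \<in> P" "\<And>r. \<not> p dvd r \<Longrightarrow> of_nat r \<notin> P"
    using P.ex_residue_characteristic by blast
  have Pkernel: "\<exists>a. x [^] (p ^ a) = \<one>" if x: "x \<in> carrier G" "P.mat_cong m x \<one>" for x
  proof -
    obtain k where "k > 0" "x [^] (k::nat) = \<one>" using tors[OF x(1)] by blast
    from congruence_kernel_prime_power[OF P.finite_prime_axioms GA p(1,3) x this]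
    show ?thesis by blast
  qed
  have P_rep: "P.mat_rep m x = P.mat_rep m y \<longleftrightarrow> P.mat_cong m x y" if "x \<in> carrier G" "y \<in> carrier G" for x y
    using P.mat_rep_eq_iff GA that by blast
  have fin_P: "finite (P.mat_rep m ` carrier G)"
    using finite_subset[OF image_mono[OF GA] P.finite_mat_rep] .
  show ?thesis
  proof (cases "(of_nat p :: 'f) = 0")
    case False
    then obtain Q where Q: "finite_prime A Q" "of_nat p \<notin> Q" using ex_prime of_nat by blast
    interpret Q: finite_prime A Q by (rule Q)
    obtain q where q: "prime q" "of_nat q \<in> Q" "\<And>r. \<not> q dvd r \<Longrightarrow> of_nat r \<notin> Q"
      using Q.ex_residue_characteristic by blast
    have "p \<noteq> q" using Q(2) q(2) by blast
    have Qkernel: "\<exists>a. x [^] (q ^ a) = \<one>" if x: "x \<in> carrier G" "Q.mat_cong m x \<one>" for x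
    proof -
      obtain k where "k > 0" "x [^] (k::nat) = \<one>" using tors[OF x(1)] by blast
      from congruence_kernel_prime_power[OF Q.finite_prime_axioms GA q(1,3) x this]
      show ?thesis by blast
    qed
    have "inj_on (\<lambda>x. (P.mat_rep m x, Q.mat_rep m x)) (carrier G)"
    proof (rule inj_onI)
      fix x y assume x: "x \<in> carrier G" and y: "y \<in> carrier G"
        and eq: "(P.mat_rep m x, Q.mat_rep m x) = (P.mat_rep m y, Q.mat_rep m y)"
      define z where "z = inv x \<otimes> y"
      have z: "z \<in> carrier G" using x y by (simp add: z_def)
      have "P.mat_cong m x y" using eq P_rep[OF x y] by blast
      then have "P.mat_cong m z \<one>" unfolding z_def using cong_one_iff[OF P.coeff_ideal_axioms GA x y] by blast
      then obtain a where "z [^] (p ^ a) = \<one>" using Pkernel z by blast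
      then have "ord z dvd p ^ a" using pow_eq_id[OF z] by blast
      have "Q.mat_cong m x y" using eq Q.mat_rep_eq_iff[of x m y] GA x y by blast
      then have "Q.mat_cong m z \<one>" unfolding z_def using cong_one_iff[OF Q.coeff_ideal_axioms GA x y] by blast
      then obtain b where "z [^] (q ^ b) = \<one>" using Qkernel z by blast
      then have "ord z dvd q ^ b" using pow_eq_id[OF z] by blast
      moreover have "coprime (p ^ a) (q ^ b)" using primes_coprime[OF p(1) q(1) \<open>p \<noteq> q\<close>] by simp
      ultimately have "ord z = 1" using \<open>ord z dvd p ^ a\<close> coprime_common_divisor_nat by blast
      then have "z = \<one>" using ord_eq_1[OF z] by blast
      then have "x \<otimes> z = x" using x by simp
      then show "x = y" unfolding z_def using x y by (simp add: m_assoc[symmetric])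
    qed
    moreover have "finite ((\<lambda>x. (P.mat_rep m x, Q.mat_rep m x)) ` carrier G)"
    proof (rule finite_subset)
      show "(\<lambda>x. (P.mat_rep m x, Q.mat_rep m x)) ` carrier G \<subseteq>
        P.mat_rep m ` mats_over m A \<times> Q.mat_rep m ` mats_over m A" using GA by auto
      show "finite (P.mat_rep m ` mats_over m A \<times> Q.mat_rep m ` mats_over m A)"
        by (intro finite_cartesian_product P.finite_mat_rep Q.finite_mat_rep)
    qed
    ultimately show ?thesis by (rule finite_imageD[rotated])
  next
    case True
    define K where "K = {x \<in> carrier G. P.mat_cong m x \<one>}"
    have K: "subgroup K G" unfolding K_def by (rule subgroup_congruence_kernel[OF P.coeff_ideal_axioms GA])
    have KA: "K \<subseteq> mats_over m A" using GA by (auto simp: K_def)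
    define t where "t x = (SOME y. y \<in> carrier G \<and> P.mat_rep m y = P.mat_rep m x)" for x
    have t: "t x \<in> carrier G" "P.mat_rep m (t x) = P.mat_rep m x" if "x \<in> carrier G" for x
      using someI[of "\<lambda>y. y \<in> carrier G \<and> P.mat_rep m y = P.mat_rep m x" x] that unfolding t_def by auto
    have "t ` carrier G = (\<lambda>M. SOME y. y \<in> carrier G \<and> P.mat_rep m y = M) ` P.mat_rep m ` carrier G"
      unfolding t_def image_image ..
    then have fin_t: "finite (t ` carrier G)" using fin_P by simp
    have tK: "inv (t x) \<otimes> x \<in> K" if x: "x \<in> carrier G" for x
    proof -
      have "P.mat_cong m (t x) x" using P_rep[OF t(1)[OF x] x] t(2)[OF x] by blast
      then show ?thesis unfolding K_def
        using cong_one_iff[OF P.coeff_ideal_axioms GA t(1)[OF x] x] t(1)[OF x] x by simp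
    qed
    \<comment> \<open>Schreier generators of a subgroup of the congruence kernel \<open>K\<close>\<close>
    define Y0 where "Y0 = (\<lambda>(s, u). inv (t (s \<otimes> u)) \<otimes> (s \<otimes> u)) ` (S' \<times> t ` carrier G)"
    define Y where "Y = Y0 \<union> m_inv G ` Y0"
    have "Y0 \<subseteq> K" unfolding Y0_def using tK S'(2) t(1) by auto
    then have YK: "Y \<subseteq> K" unfolding Y_def using subgroup.m_inv_closed[OF K] by blast
    have YG: "Y \<subseteq> carrier G" using YK by (auto simp: K_def)
    have "finite Y0" unfolding Y0_def using S'(1) fin_t by simp
    then have finY: "finite Y" by (simp add: Y_def)
    have invY: "m_inv G ` Y \<subseteq> Y"
    proof
      fix x assume "x \<in> m_inv G ` Y"
      then obtain y where y: "y \<in> Y" "x = inv y" by blast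
      then consider "y \<in> Y0" | z where "z \<in> Y0" "y = inv z" unfolding Y_def by blast
      then show "x \<in> Y"
      proof cases
        case 1
        then show ?thesis using y by (simp add: Y_def)
      next
        case 2
        then have "x = z" using y \<open>Y0 \<subseteq> K\<close> by (auto simp: K_def)
        then show ?thesis using 2 by (simp add: Y_def)
      qed
    qed
    have nil: "diff_one_prod m Xs = 0\<^sub>m m m" if Xs: "set Xs \<subseteq> Y" "length Xs = m" for Xs
    proof (rule eq_matI)
      fix i j assume "i < dim_row (0\<^sub>m m m :: 'f mat)" "j < dim_col (0\<^sub>m m m :: 'f mat)"
      then have ij: "i < m" "j < m" by auto
      have "diff_one_prod m Xs \<in> mats_over m A" using Xs(1)
      proof (induction Xs)
        case Nil
        show ?case by (simp add: diff_one_prod_simps mats_over_closed)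
      next
        case (Cons X Xs)
        then have "X \<in> mats_over m A" using YK KA by auto
        then show ?case using Cons by (simp add: diff_one_prod_simps mats_over_closed)
      qed
      then have bA: "diff_one_prod m Xs $$ (i, j) \<in> A" using mats_overD(2) ij by blast
      have "diff_one_prod m Xs $$ (i, j) = 0"
      proof (rule ccontr)
        assume "diff_one_prod m Xs $$ (i, j) \<noteq> 0"
        then obtain Q where Q: "finite_prime A Q" "diff_one_prod m Xs $$ (i, j) \<notin> Q"
          using ex_prime bA by blast
        interpret Q: finite_prime A Q by (rule Q)
        have "diff_one_prod m Xs $$ (i, j) \<in> Q"
        proof (rule Q.unipotent_diff_one_prod[OF KA _ _ p(1) _ _ _ Xs(2) ij])
          show "1\<^sub>m m \<in> K" using subgroup.one_closed[OF K] one_eq by simp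
          show "x * y \<in> K" if "x \<in> K" "y \<in> K" for x y
            using subgroup.m_closed[OF K that] mult_eq[of x y] that by (simp add: K_def)
          show "of_nat p \<in> Q" using True Q.ideal_zero by simp
          show "\<exists>k. x ^\<^sub>m (p ^ k) = 1\<^sub>m m" if "x \<in> K" for x
            using Pkernel[of x] that pow_eq[of x] one_eq by (simp add: K_def)
          show "set Xs \<subseteq> K" using Xs(1) YK by blast
        qed
        then show False using Q(2) by blast
      qed
      then show "diff_one_prod m Xs $$ (i, j) = 0\<^sub>m m m $$ (i, j)" using ij by simp
    qed (use diff_one_prod_carrier[of m Xs] in auto)
    define N where "N = generate G Y"
    have finN: "finite N" unfolding N_def
      by (rule finite_generate_unipotent[OF finY YG invY prime_gt_0_nat[OF p(1)] True nil])
    have NG: "k \<in> carrier G" if "k \<in> N" for k using that generate_in_carrier[OF YG] by (simp add: N_def)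
    define D where "D = (\<lambda>(u, k). u \<otimes> k) ` (t ` carrier G \<times> N)"
    have finD: "finite D" unfolding D_def using fin_t finN by simp
    have DG: "D \<subseteq> carrier G" unfolding D_def using t(1) NG by auto
    have step: "s \<otimes> d \<in> D" if s: "s \<in> S'" and d: "d \<in> D" for s d
    proof -
      obtain u k where u: "u \<in> t ` carrier G" and k: "k \<in> N" and "d = u \<otimes> k"
        using d unfolding D_def by auto
      have G: "s \<in> carrier G" "u \<in> carrier G" "k \<in> carrier G" using s S'(2) u t(1) NG[OF k] by auto
      define y where "y = inv (t (s \<otimes> u)) \<otimes> (s \<otimes> u)"
      have "y \<in> Y" unfolding y_def Y_def Y0_def using s u by force
      then have yk: "y \<otimes> k \<in> N"
        using k unfolding N_def by (intro generate.eng[OF generate.incl])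
      have su: "s \<otimes> u \<in> carrier G" "t (s \<otimes> u) \<in> carrier G" using G t(1) by simp_all
      then have "t (s \<otimes> u) \<otimes> (y \<otimes> k) = s \<otimes> u \<otimes> k"
        unfolding y_def using G(3) by (simp add: m_assoc[symmetric])
      then have "s \<otimes> d = t (s \<otimes> u) \<otimes> (y \<otimes> k)"
        unfolding \<open>d = u \<otimes> k\<close> using G by (simp add: m_assoc)
      then show ?thesis unfolding D_def using su(1) yk
        by (intro image_eqI[of _ _ "(t (s \<otimes> u), y \<otimes> k)"]) simp_all
    qed
    have gen: "h \<otimes> d \<in> D" if "h \<in> generate G S" "d \<in> D" for h d
      using that
    proof (induction arbitrary: d)
      case one
      then show ?case using DG by auto
    next
      case (incl h)
      then show ?case using step by (simp add: S'_def)
    next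
      case (inv h)
      then show ?case using step by (simp add: S'_def)
    next
      case (eng g h)
      have "g \<in> carrier G" "h \<in> carrier G" "d \<in> carrier G"
        using generate_in_carrier[OF S(2)] eng DG by auto
      then show ?case using eng by (simp add: m_assoc)
    qed
    have "t \<one> \<otimes> \<one> \<in> D" unfolding D_def N_def
      by (rule image_eqI[of _ _ "(t \<one>, \<one>)"]) (simp_all add: generate.one)
    then have d: "t \<one> \<in> D" using t(1) by simp
    have "carrier G \<subseteq> D"
    proof
      fix h assume h: "h \<in> carrier G"
      have "(h \<otimes> inv (t \<one>)) \<otimes> t \<one> \<in> D"
        using gen[OF _ d] h t(1) S(3) by simp
      then show "h \<in> D" using h t(1) by (simp add: m_assoc)
    qed
    then show ?thesis using finD finite_subset by blast
  qed
qed

end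

section \<open>The regular representation\<close>

context field_algebra
begin

lemma subalgebra_hull: "subalgebra (subalgebra hull E)"
  by (rule hull_in) (auto simp: subalgebra_def subspace_def)

text \<open>The matrix over the base field of left multiplication by \<open>a\<close> on the span of the basis \<open>bs\<close>;
  \<open>regular_mat\<close> applies it to each entry of an \<open>n \<times> n\<close> matrix.\<close>

definition regular_coeff :: "'a list \<Rightarrow> 'a \<Rightarrow> nat \<Rightarrow> nat \<Rightarrow> 'f" where
  "regular_coeff bs a k l = representation (set bs) (a * bs ! l) (bs ! k)"

definition regular_mat :: "nat \<Rightarrow> 'a list \<Rightarrow> 'a mat \<Rightarrow> 'f mat" where
  "regular_mat n bs X = mat (n * length bs) (n * length bs) (\<lambda>(u, v).
    regular_coeff bs (X $$ (u div length bs, v div length bs)) (u mod length bs) (v mod length bs))"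

end

lemma add_mult_div_mod:
  assumes "g < (d::nat)"
  shows "(g + h * d) div d = h" "(g + h * d) mod d = g"
  using assms by auto

lemma sum_lessThan_mult: "sum f {..<n * d :: nat} = (\<Sum>h<n. \<Sum>g<d. f (g + h * d))"
  unfolding sum.nat_group[of f d n, symmetric]
  by (rule sum.cong[OF refl]) (simp add: sum.atLeastLessThan_shift_0 atLeast0LessThan add.commute)

locale based_subalgebra = field_algebra scale
  for scale :: "'f::field \<Rightarrow> 'a::ring_1 \<Rightarrow> 'a" (infixr "*s" 75) +
  fixes bs :: "'a list"
  assumes bs: "distinct bs" "independent (set bs)" and subalg: "subalgebra (span (set bs))"
begin

abbreviation B where "B \<equiv> span (set bs)"

abbreviation r where "r \<equiv> length bs"

lemma B_closed: "1 \<in> B" "x \<in> B \<Longrightarrow> y \<in> B \<Longrightarrow> x * y \<in> B"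
  using subalg unfolding subalgebra_def by auto

lemma nth_in_B: "l < r \<Longrightarrow> bs ! l \<in> B"
  by (simp add: span_base)

lemma regular_coeff_expand:
  assumes "a \<in> B" "l < r"
  shows "a * bs ! l = (\<Sum>k<r. regular_coeff bs a k l *s bs ! k)"
proof -
  have "a * bs ! l \<in> B" using B_closed(2)[OF assms(1) nth_in_B[OF assms(2)]] .
  then have "a * bs ! l = (\<Sum>b\<in>set bs. representation (set bs) (a * bs ! l) b *s b)"
    using sum_representation_eq[OF bs(2)] by simp
  also have "\<dots> = (\<Sum>k<r. regular_coeff bs a k l *s bs ! k)"
    unfolding regular_coeff_def
    by (rule sum.reindex_bij_betw[OF bij_betw_nth[OF bs(1)], symmetric]) simp_all
  finally show ?thesis .
qed

lemma regular_coeff_mult: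
  assumes "a \<in> B" "a' \<in> B" "l < r"
  shows "regular_coeff bs (a * a') k l = (\<Sum>i<r. regular_coeff bs a k i * regular_coeff bs a' i l)"
proof -
  have "a * a' * bs ! l = (\<Sum>i<r. regular_coeff bs a' i l *s (a * bs ! i))"
    using regular_coeff_expand[OF assms(2,3)] by (simp add: mult.assoc sum_distrib_left scale_mult_right)
  then have "regular_coeff bs (a * a') k l =
      representation (set bs) (\<Sum>i<r. regular_coeff bs a' i l *s (a * bs ! i)) (bs ! k)"
    by (simp add: regular_coeff_def)
  also have "\<dots> = (\<Sum>i<r. representation (set bs) (regular_coeff bs a' i l *s (a * bs ! i)) (bs ! k))"
    using representation_sum[OF bs(2), of "{..<r}" "\<lambda>i. regular_coeff bs a' i l *s (a * bs ! i)"]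
      assms(1) nth_in_B by (simp add: span_scale B_closed)
  also have "\<dots> = (\<Sum>i<r. regular_coeff bs a k i * regular_coeff bs a' i l)"
    using representation_scale[OF bs(2)] assms(1) nth_in_B
    by (intro sum.cong) (simp_all add: regular_coeff_def B_closed mult.commute)
  finally show ?thesis .
qed

lemma regular_coeff_sum:
  assumes "\<And>i. i \<in> I \<Longrightarrow> f i \<in> B" "l < r"
  shows "regular_coeff bs (sum f I) k l = (\<Sum>i\<in>I. regular_coeff bs (f i) k l)"
  unfolding regular_coeff_def sum_distrib_right
  using representation_sum[OF bs(2), of I "\<lambda>i. f i * bs ! l"] assms nth_in_B by (simp add: B_closed)

lemma regular_coeff_one:
  assumes "k < r" "l < r"
  shows "regular_coeff bs 1 k l = (if k = l then 1 else 0)"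
  using representation_basis[OF bs(2), of "bs ! l"] assms bs(1)
  by (simp add: regular_coeff_def nth_eq_iff_index_eq)

lemma regular_coeff_zero: "regular_coeff bs 0 k l = 0"
  by (simp add: regular_coeff_def representation_zero)

lemma regular_coeff_inj:
  assumes a: "a \<in> B" "a' \<in> B" and eq: "\<And>k l. k < r \<Longrightarrow> l < r \<Longrightarrow> regular_coeff bs a k l = regular_coeff bs a' k l"
  shows "a = a'"
proof -
  have eq_nth: "a * bs ! l = a' * bs ! l" if "l < r" for l
    unfolding regular_coeff_expand[OF a(1) that] regular_coeff_expand[OF a(2) that]
    using eq that by (intro sum.cong) auto
  have "a * x = a' * x" if "x \<in> B" for x
    using that
  proof (induction rule: span_induct_alt)
    case base
    show ?case by simp
  next
    case (step c x y)
    then obtain l where "l < r" "x = bs ! l" by (auto simp: in_set_conv_nth)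
    then show ?case using eq_nth step by (simp add: distrib_left scale_mult_right)
  qed
  from this[OF B_closed(1)] show ?thesis by simp
qed

lemma mod_div_bounds:
  assumes "u < n * r"
  shows "u div r < n" "u mod r < r"
proof -
  have "r > 0" using assms by (cases "r = 0") auto
  then show "u mod r < r" by simp
  show "u div r < n" using assms by (simp add: less_mult_imp_div_less)
qed

lemma regular_mat_mult:
  assumes X: "X \<in> mats_over n B" and Y: "Y \<in> mats_over n B"
  shows "regular_mat n bs (X * Y) = regular_mat n bs X * regular_mat n bs Y"
proof (rule eq_matI)
  fix u v assume "u < dim_row (regular_mat n bs X * regular_mat n bs Y)"
    "v < dim_col (regular_mat n bs X * regular_mat n bs Y)"
  then have uv: "u < n * r" "v < n * r" by (simp_all add: regular_mat_def)
  define i k j l where "i = u div r" and "k = u mod r" and "j = v div r" and "l = v mod r"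
  have b: "i < n" "k < r" "j < n" "l < r"
    using mod_div_bounds[OF uv(1)] mod_div_bounds[OF uv(2)] by (simp_all add: i_def k_def j_def l_def)
  have "regular_mat n bs (X * Y) $$ (u, v) = regular_coeff bs ((X * Y) $$ (i, j)) k l"
    using uv by (simp add: regular_mat_def i_def j_def k_def l_def)
  also have "(X * Y) $$ (i, j) = (\<Sum>h<n. X $$ (i, h) * Y $$ (h, j))"
    using mats_overD(1)[OF X] mats_overD(1)[OF Y] b by (simp add: scalar_prod_def atLeast0LessThan)
  also have "regular_coeff bs \<dots> k l = (\<Sum>h<n. regular_coeff bs (X $$ (i, h) * Y $$ (h, j)) k l)"
    using mats_overD(2)[OF X] mats_overD(2)[OF Y] b by (intro regular_coeff_sum) (auto intro: B_closed)
  also have "\<dots> = (\<Sum>h<n. \<Sum>g<r. regular_coeff bs (X $$ (i, h)) k g * regular_coeff bs (Y $$ (h, j)) g l)"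
    using mats_overD(2)[OF X] mats_overD(2)[OF Y] b by (intro sum.cong refl regular_coeff_mult) auto
  also have "\<dots> = (\<Sum>h<n. \<Sum>g<r. regular_mat n bs X $$ (u, g + h * r) * regular_mat n bs Y $$ (g + h * r, v))"
  proof (intro sum.cong refl)
    fix h g assume "h \<in> {..<n}" "g \<in> {..<r}"
    then have hg: "h < n" "g < r" by auto
    then have "g + h * r < Suc h * r" by simp
    also have "\<dots> \<le> n * r" using hg by (intro mult_le_mono1) simp
    finally have "g + h * r < n * r" .
    moreover note add_mult_div_mod[OF hg(2), of h]
    ultimately show "regular_coeff bs (X $$ (i, h)) k g * regular_coeff bs (Y $$ (h, j)) g l =
        regular_mat n bs X $$ (u, g + h * r) * regular_mat n bs Y $$ (g + h * r, v)"
      using uv by (simp add: regular_mat_def i_def j_def k_def l_def)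
  qed
  also have "\<dots> = (\<Sum>w<n * r. regular_mat n bs X $$ (u, w) * regular_mat n bs Y $$ (w, v))"
    by (rule sum_lessThan_mult[symmetric])
  also have "\<dots> = (regular_mat n bs X * regular_mat n bs Y) $$ (u, v)"
    using uv by (intro index_mult_mat_sum[symmetric]) (auto simp: regular_mat_def)
  finally show "regular_mat n bs (X * Y) $$ (u, v) = (regular_mat n bs X * regular_mat n bs Y) $$ (u, v)" .
qed (simp_all add: regular_mat_def)

lemma regular_mat_one: "regular_mat n bs (1\<^sub>m n) = 1\<^sub>m (n * r)"
proof (rule eq_matI)
  fix u v assume "u < dim_row (1\<^sub>m (n * r) :: 'f mat)" "v < dim_col (1\<^sub>m (n * r) :: 'f mat)"
  then have uv: "u < n * r" "v < n * r" by simp_all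
  note b = mod_div_bounds[OF uv(1)] mod_div_bounds[OF uv(2)]
  have "u = v \<longleftrightarrow> u div r = v div r \<and> u mod r = v mod r" by (metis div_mult_mod_eq)
  then show "regular_mat n bs (1\<^sub>m n) $$ (u, v) = 1\<^sub>m (n * r) $$ (u, v)"
    using uv b by (simp add: regular_mat_def regular_coeff_one regular_coeff_zero)
qed (simp_all add: regular_mat_def)

lemma regular_mat_inj: "inj_on (regular_mat n bs) (mats_over n B)"
proof (rule inj_onI)
  fix X Y assume X: "X \<in> mats_over n B" and Y: "Y \<in> mats_over n B"
    and eq: "regular_mat n bs X = regular_mat n bs Y"
  show "X = Y"
  proof (rule eq_matI)
    fix i j assume "i < dim_row Y" "j < dim_col Y"
    then have ij: "i < n" "j < n" using mats_overD(1)[OF Y] by auto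
    show "X $$ (i, j) = Y $$ (i, j)"
    proof (rule regular_coeff_inj)
      show "X $$ (i, j) \<in> B" "Y $$ (i, j) \<in> B" using mats_overD(2) X Y ij by blast+
      fix k l assume kl: "k < r" "l < r"
      have bound: "k + i * r < n * r" if "i < n" "k < r" for i k
      proof -
        have "k + i * r < Suc i * r" using that by simp
        also have "\<dots> \<le> n * r" using that by (intro mult_le_mono1) simp
        finally show ?thesis .
      qed
      have "regular_mat n bs X $$ (k + i * r, l + j * r) = regular_mat n bs Y $$ (k + i * r, l + j * r)"
        by (simp only: eq)
      then show "regular_coeff bs (X $$ (i, j)) k l = regular_coeff bs (Y $$ (i, j)) k l"
        using bound ij kl add_mult_div_mod by (simp add: regular_mat_def)
    qed
  qed (use mats_overD(1)[OF X] mats_overD(1)[OF Y] in auto)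
qed

lemma finite_torsion_group:
  fixes L :: "'a mat monoid"
  assumes "group L" and L: "carrier L \<subseteq> mats_over n B" "\<one>\<^bsub>L\<^esub> = 1\<^sub>m n"
      "\<And>x y. x \<in> carrier L \<Longrightarrow> y \<in> carrier L \<Longrightarrow> x \<otimes>\<^bsub>L\<^esub> y = x * y"
    and S: "finite S" "S \<subseteq> carrier L" "generate L S = carrier L"
    and tors: "\<And>x. x \<in> carrier L \<Longrightarrow> \<exists>k>0. x [^]\<^bsub>L\<^esub> (k::nat) = \<one>\<^bsub>L\<^esub>"
  shows "finite (carrier L)"
proof -
  interpret L: group L by fact
  let ?\<Phi> = "regular_mat n bs"
  define M :: "'f mat monoid" where "M = \<lparr>carrier = carrier_mat (n * r) (n * r), mult = (*), one = 1\<^sub>m (n * r)\<rparr>"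
  define H where "H = M\<lparr>carrier := ?\<Phi> ` carrier L, one := ?\<Phi> \<one>\<^bsub>L\<^esub>\<rparr>"
  have multH: "x \<otimes>\<^bsub>H\<^esub> y = x * y" for x y unfolding H_def M_def by simp
  have homM: "?\<Phi> \<in> hom L M"
    unfolding hom_def using L regular_mat_mult by (auto simp: M_def regular_mat_def subset_iff)
  interpret H: group H unfolding H_def by (rule L.hom_imp_img_group[OF homM])
  interpret \<Phi>: group_hom L H ?\<Phi>
    by unfold_locales (use homM in \<open>auto simp: H_def hom_def\<close>)
  have H_group: "matrix_group H (n * r)"
  proof (intro matrix_group.intro matrix_group_axioms.intro H.group_axioms)
    show "carrier H \<subseteq> carrier_mat (n * r) (n * r)" by (auto simp: H_def regular_mat_def)
    show "\<one>\<^bsub>H\<^esub> = 1\<^sub>m (n * r)" by (simp add: H_def L(2) regular_mat_one)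
  qed (rule multH)
  have carr: "carrier H = ?\<Phi> ` carrier L" 
  proof -
    have "carrier (M\<lparr>carrier := C, one := e\<rparr>) = C" for C e by simp
    then show ?thesis unfolding H_def .
  qed
  have "finite (carrier H)"
  proof (rule matrix_group.finite_carrier_of_torsion[OF H_group])
    show "finite (?\<Phi> ` S)" using S(1) by simp
    show "?\<Phi> ` S \<subseteq> carrier H" using S(2) carr by auto
    show "generate H (?\<Phi> ` S) = carrier H" unfolding \<Phi>.generate_img[OF S(2)] S(3) carr ..
    fix x assume "x \<in> carrier H"
    then obtain y where y: "y \<in> carrier L" "x = ?\<Phi> y" using carr by blast
    then obtain k :: nat where "k > 0" "y [^]\<^bsub>L\<^esub> k = \<one>\<^bsub>L\<^esub>" using tors by blast
    then have "x [^]\<^bsub>H\<^esub> k = \<one>\<^bsub>H\<^esub>" using \<Phi>.hom_nat_pow[OF y(1), of k] y(2) by simp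
    then show "\<exists>k>0. x [^]\<^bsub>H\<^esub> (k::nat) = \<one>\<^bsub>H\<^esub>" using \<open>k > 0\<close> by blast
  qed
  moreover have "inj_on ?\<Phi> (carrier L)" by (rule inj_on_subset[OF regular_mat_inj L(1)])
  ultimately show ?thesis unfolding carr by (rule finite_imageD)
qed

end

theorem theorem6p11:
  fixes scale :: "'f :: field \<Rightarrow> 'a :: ring_1 \<Rightarrow> 'a"
    and n :: nat
    and G :: "'a mat set"
  assumes "locally_finite_algebra scale"
    and "n \<ge> 1"
    and "subgroup G (general_linear_group TYPE('a) n)"
    and "periodic_group ((general_linear_group TYPE('a) n)\<lparr>carrier := G\<rparr>)"
  shows "locally_finite_group ((general_linear_group TYPE('a) n)\<lparr>carrier := G\<rparr>)"
proof -
  interpret locally_finite_algebra scale by fact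
  define GL where "GL = general_linear_group TYPE('a) n"
  have GL: "mult GL = (*)" "one GL = 1\<^sub>m n" "carrier GL \<subseteq> carrier_mat n n"
    by (auto simp: GL_def general_linear_group_def units_of_def Units_def ring_mat_def)
  define H where "H = GL\<lparr>carrier := G\<rparr>"
  have "subgroup G GL" using assms(3) by (simp add: GL_def)
  then have GC: "G \<subseteq> carrier_mat n n" using GL(3) subgroup.subset by blast
  have per: "periodic_group H" using assms(4) by (simp add: H_def GL_def)
  then interpret H: group H by (simp add: periodic_group_def)
  have carr: "carrier H = G" by (simp add: H_def)
  have "finite (generate H S)" if S: "S \<subseteq> carrier H" "finite S" for S
  proof -
    define S' where "S' = S \<union> m_inv H ` S"
    have S': "S' \<subseteq> carrier_mat n n" using S(1) H.inv_closed carr GC by (auto simp: S'_def)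
    define E where "E = (\<Union>X\<in>S'. (\<lambda>(i, j). X $$ (i, j)) ` ({..<n} \<times> {..<n}))"
    have "finite E" unfolding E_def S'_def using S(2) by (intro finite_UN_I) auto
    then obtain T where T: "finite T" "independent T" "span T = subalgebra hull E"
      using finite_dimensional_generated unfolding finite_dimensional_def by blast
    obtain bs where bsT: "set bs = T" "distinct bs" using finite_distinct_list[OF T(1)] by blast
    interpret based_subalgebra scale bs
      by unfold_locales (use bsT T subalgebra_hull in auto)
    have "S' \<subseteq> mats_over n B"
    proof
      fix X assume X: "X \<in> S'"
      then have "X $$ (i, j) \<in> E" if "i < n" "j < n" for i j
        unfolding E_def using that by (intro UN_I[OF X]) auto
      moreover have "E \<subseteq> B" unfolding bsT(1) T(3) by (rule hull_subset)
      ultimately show "X \<in> mats_over n B" using X S' unfolding mats_over_def by blast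
    qed
    define L where "L = generate H S"
    have LB: "L \<subseteq> mats_over n B"
    proof
      fix x assume "x \<in> L"
      then show "x \<in> mats_over n B" unfolding L_def
      proof induction
        case one
        have "1\<^sub>m n \<in> mats_over n B" by (auto simp: mats_over_def B_closed span_zero)
        then show ?case by (simp add: H_def GL(2))
      next
        case (incl h)
        then show ?case using \<open>S' \<subseteq> mats_over n B\<close> by (auto simp: S'_def)
      next
        case (inv h)
        then show ?case using \<open>S' \<subseteq> mats_over n B\<close> by (auto simp: S'_def)
      next
        case (eng g h)
        have "g * h \<in> mats_over n B"
          unfolding mats_over_def
        proof (intro CollectI conjI allI impI)
          show "g * h \<in> carrier_mat n n" using eng(3,4)[THEN mats_overD(1)] by (rule mult_carrier_mat)
          fix i j assume ij: "i < n" "j < n"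
          have "(g * h) $$ (i, j) = (\<Sum>k<n. g $$ (i, k) * h $$ (k, j))"
            using eng(3,4)[THEN mats_overD(1)] ij by (simp add: scalar_prod_def atLeast0LessThan)
          also have "\<dots> \<in> B"
            using eng(3,4)[THEN mats_overD(2)] ij by (auto intro!: span_sum B_closed)
          finally show "(g * h) $$ (i, j) \<in> B" .
        qed
        then show ?case by (simp add: H_def GL(1))
      qed
    qed
    have sub: "subgroup L H" unfolding L_def by (rule H.generate_is_subgroup[OF S(1)])
    define K where "K = H\<lparr>carrier := L\<rparr>"
    have "finite (carrier K)"
    proof (rule finite_torsion_group)
      show "group K" unfolding K_def by (rule H.subgroup_imp_group[OF sub])
      show "carrier K \<subseteq> mats_over n B" using LB by (simp add: K_def)
      show "\<one>\<^bsub>K\<^esub> = 1\<^sub>m n" by (simp add: K_def H_def GL(2))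
      show "x \<otimes>\<^bsub>K\<^esub> y = x * y" for x y by (simp add: K_def H_def GL(1))
      show "finite S" by (rule S)
      have SL: "S \<subseteq> L" unfolding L_def by (intro subsetI generate.incl)
      then show "S \<subseteq> carrier K" by (simp add: K_def)
      show "generate K S = carrier K"
        unfolding K_def using H.generate_consistent[OF SL sub] by (simp add: L_def)
      fix x assume "x \<in> carrier K"
      then have "x \<in> carrier H" using subgroup.subset[OF sub] by (auto simp: K_def)
      then obtain k :: nat where "k > 0" "x [^]\<^bsub>H\<^esub> k = \<one>\<^bsub>H\<^esub>"
        using per unfolding periodic_group_def by blast
      then show "\<exists>k>0. x [^]\<^bsub>K\<^esub> (k::nat) = \<one>\<^bsub>K\<^esub>"
        using H.nat_pow_consistent[of x k L] by (auto simp: K_def)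
    qed
    then show ?thesis by (simp add: K_def L_def)
  qed
  then have "locally_finite_group H" unfolding locally_finite_group_def using H.group_axioms by blast
  then show ?thesis by (simp add: H_def GL_def)
qed

end
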